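(* Let $k$ be a positive integer and let $G$ be a claw-free graph of order $n$. If $\sigma_{k+1}(G)\geq n$ and $\delta(G)\geq \alpha(G)+1$, then $G$ has a 2-factor with at most $k$ cycles.
   Context: All graphs are simple, finite, and undirected. The order of a graph is its number of vertices. A graph is claw-free if it contains no induced subgraph isomorphic to $K_{1,3}$. $\delta(G)$ denotes the minimum degree of $G$ and $\alpha(G)$ the independence number of $G$. A 2-factor of $G$ is a 2-regular spanning subgraph of $G$; it is a vertex-disjoint union of cycles (its components), and "at most $k$ cycles" means that it has at most $k$ components. For a positive integer $m$, $\sigma_m(G)=\min\{\sum_{v\in I}d_G(v) : I \text{ is an independent set of } G \text{ with } |I|=m\}$ if $\alpha(G)\geq m$, and $\sigma_m(G)=\infty$ otherwise. *)

theory Defs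
  imports "Graph_Theory.Graph_Theory" "HOL-Library.Extended_Nat"
begin

text \<open>
  A finite simple undirected graph is a value satisfying the locale predicate \<^const>\<open>graph\<close>:
  finite, loop-free, without parallel arcs, and symmetric. Each undirected edge is represented by
  its two opposite arcs, so the degree of a vertex is its \<^const>\<open>out_degree\<close>.
\<close>

definition claw_free :: "('a, 'b) pre_digraph \<Rightarrow> bool" where
  "claw_free G \<longleftrightarrow> \<not> (\<exists>H. induced_subgraph H G \<and> complete_bipartite_digraph 1 3 H)"

definition min_degree :: "('a, 'b) pre_digraph \<Rightarrow> nat" where
  "min_degree G = Min (out_degree G ` verts G)"

definition indep_set :: "('a, 'b) pre_digraph \<Rightarrow> 'a set \<Rightarrow> bool" where
  "indep_set G I \<longleftrightarrow> I \<subseteq> verts G \<and> (\<forall>u\<in>I. \<forall>v\<in>I. (u, v) \<notin> arcs_ends G)"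

definition indep_number :: "('a, 'b) pre_digraph \<Rightarrow> nat" where
  "indep_number G = Max {card I | I. indep_set G I}"

definition degree_sum :: "nat \<Rightarrow> ('a, 'b) pre_digraph \<Rightarrow> enat" where
  "degree_sum m G =
     (if m \<le> indep_number G
      then enat (Min {\<Sum>v\<in>I. out_degree G v | I. indep_set G I \<and> card I = m})
      else \<infinity>)"

definition two_factor :: "('a, 'b) pre_digraph \<Rightarrow> ('a, 'b) pre_digraph \<Rightarrow> bool" where
  "two_factor F G \<longleftrightarrow> spanning F G \<and> graph F \<and> (\<forall>v\<in>verts F. out_degree F v = 2)"

text \<open>
  In a symmetric digraph the strongly connected components are the connected components of the
  underlying undirected graph.
\<close>

definition num_components :: "('a, 'b) pre_digraph \<Rightarrow> nat" where
  "num_components G = card (pre_digraph.sccs G)"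

end

theory Submission
  imports Defs "HOL-Library.Disjoint_Sets"
begin

text \<open>
  Call a set of vertices \<^emph>\<open>cyclable\<close> if it is the vertex set of a cycle, where a single vertex and
  the two ends of an edge count as degenerate cycles. The theorem follows from two facts.

  First, let \<open>\<delta> \<ge> \<alpha> + 1\<close>. Then a partition into cyclable sets with the least number of parts has
  only parts with at least three vertices, so it is a 2-factor
  (\<open>minimal_cyc_partition_no_small_parts\<close>). Indeed, if \<open>v\<close> lies in a smaller part, then \<open>v\<close> and the
  successors, on their cycles, of its neighbours in the other parts are more than \<open>\<alpha>\<close> vertices. Two
  of them are adjacent, and this edge allows one to reroute one or two of the other cycles through
  \<open>v\<close>, which in the end gives a partition with fewer parts.

  Second, let every independent set of \<open>k + 1\<close> vertices in a claw-free graph without isolated vertices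
  have degree sum at least \<open>n\<close>. Then there is a partition into at most \<open>k\<close> cyclable sets
  (\<open>claw_free_cyc_partition\<close>). This is proved with the closure of Ryjacek: as long as there is an
  induced diamond, that is a complete graph on four vertices minus an edge, the neighbourhood of a
  vertex of degree three in the diamond is made complete. The graph remains claw-free, no degree
  decreases, no new independent sets arise, and a partition of the new graph can be turned into one
  of the old graph that is not larger (\<open>cyc_partition_of_local_completion\<close>). In a claw-free graph without
  diamonds every vertex lies in exactly two cliques of a certain kind, its lines. So the graph is the line graph of a
  simple graph \<open>H\<close> whose vertices are the lines.

  For \<open>H\<close> the argument is as follows (\<open>line_graph_cyc_partition\<close>). Consider a set \<open>F\<close> of edges in which
  all degrees are even and a set \<open>X\<close> of vertices such that each edge of \<open>H\<close> has an end in a component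
  of \<open>F\<close> that meets \<open>X\<close>. Choose \<open>X\<close> as small as possible and then the union of these components as
  large as possible. An Euler tour of a component, with further edges at its vertices inserted, is a
  cycle of the line graph, so there is a partition into at most \<open>card X\<close> cyclable sets. If \<open>Z\<close> is a
  non-empty set of edges with even degrees whose ends lie in a set \<open>L\<close> that meets each of these
  components in at most one vertex or in the two ends of an edge of \<open>F\<close>, then the symmetric
  difference of \<open>F\<close> and \<open>Z\<close> keeps all components connected and merges two of them or enlarges one, a contradiction. Hence there
  are fewer than \<open>card L\<close> edges between vertices of \<open>L\<close>. This yields, by Hall's theorem, a matching
  with one edge at each \<open>x \<in> X\<close> which belongs to \<open>F\<close> or leads out of all components. If \<open>card X > k\<close>,
  take \<open>k + 1\<close> edges of this matching. They are independent in the line graph, and their degree sum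
  counts every other edge at most once, or twice if both its ends are covered. As fewer than
  \<open>2 (k + 1)\<close> edges, the matching included, have both ends covered, the sum is smaller than \<open>n\<close>.
\<close>

section \<open>Graphs, cyclic lists and cyclable sets\<close>

locale ugraph =
  fixes V :: "'a set" and adj :: "'a \<Rightarrow> 'a \<Rightarrow> bool"
  assumes finV: "finite V"
    and adj_in: "adj u v \<Longrightarrow> u \<in> V \<and> v \<in> V"
    and adj_sym: "adj u v \<Longrightarrow> adj v u"
    and adj_irrefl: "\<not> adj v v"

definition indep :: "'a set \<Rightarrow> ('a \<Rightarrow> 'a \<Rightarrow> bool) \<Rightarrow> 'a set \<Rightarrow> bool" where
  "indep V adj I \<longleftrightarrow> I \<subseteq> V \<and> (\<forall>u\<in>I. \<forall>v\<in>I. \<not> adj u v)"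

text \<open>
  Lists of length one and two are admitted; they stand for the degenerate cycles.
\<close>
definition cyc_list :: "('a \<Rightarrow> 'a \<Rightarrow> bool) \<Rightarrow> 'a list \<Rightarrow> bool" where
  "cyc_list adj c \<longleftrightarrow> c \<noteq> [] \<and> distinct c \<and> successively adj c \<and> (length c = 1 \<or> adj (last c) (hd c))"

definition cyclable :: "('a \<Rightarrow> 'a \<Rightarrow> bool) \<Rightarrow> 'a set \<Rightarrow> bool" where
  "cyclable adj W \<longleftrightarrow> (\<exists>c. cyc_list adj c \<and> set c = W)"

definition cyc_partition :: "'a set \<Rightarrow> ('a \<Rightarrow> 'a \<Rightarrow> bool) \<Rightarrow> 'a set set \<Rightarrow> bool" where
  "cyc_partition V adj P \<longleftrightarrow> partition_on V P \<and> (\<forall>W\<in>P. cyclable adj W)"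

lemma cyclable_singleton: "cyclable adj {v}"
  unfolding cyclable_def cyc_list_def by (rule exI[of _ "[v]"]) simp

lemma cyc_list_append_swap:
  assumes "cyc_list adj (p @ q)"
  shows "cyc_list adj (q @ p)"
proof (cases "p = [] \<or> q = []")
  case False
  then have "length (p @ q) \<noteq> 1" by (cases p; cases q) auto
  then show ?thesis using assms False
    by (auto simp: cyc_list_def successively_append_iff)
qed (use assms in auto)

lemma cyc_list_rotate: "cyc_list adj c \<Longrightarrow> cyc_list adj (rotate n c)"
proof (induction n)
  case (Suc n)
  have "cyc_list adj (rotate1 c)" if "cyc_list adj c" for c :: "'a list"
    using cyc_list_append_swap[of adj "[hd c]" "tl c"] that
    by (cases c) auto
  then show ?case using Suc by simp
qed simp

lemma cyc_list_at:
  assumes "cyc_list adj c" "v \<in> set c"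
  obtains r where "cyc_list adj (v # r)" "set (v # r) = set c"
proof -
  obtain p q where c: "c = p @ v # q" using assms(2) by (meson split_list)
  show thesis
    by (rule that[of "q @ p"]) (use cyc_list_append_swap[of adj p "v # q"] assms(1) c in auto)
qed

text \<open>
  The successor function of a cycle is described by the two ways of cutting the cycle that are used
  below: behind one vertex, and behind two vertices.
\<close>
lemma cyclable_successor:
  assumes "cyclable adj W"
  obtains s where "bij_betw s W W"
    and "\<And>w. w \<in> W \<Longrightarrow> \<exists>c. cyc_list adj c \<and> set c = W \<and> last c = w \<and> hd c = s w"
    and "\<And>w w'. w \<in> W \<Longrightarrow> w' \<in> W \<Longrightarrow> w \<noteq> w' \<Longrightarrow>
      \<exists>p q. p \<noteq> [] \<and> q \<noteq> [] \<and> cyc_list adj (p @ q) \<and> set (p @ q) = W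
        \<and> last q = w \<and> hd p = s w \<and> last p = w' \<and> hd q = s w'"
proof -
  obtain c where c: "cyc_list adj c" "set c = W" using assms by (auto simp: cyclable_def)
  have dc: "distinct c" and nc: "c \<noteq> []" using c by (auto simp: cyc_list_def)
  let ?n = "length c"
  have n0: "?n > 0" using nc by simp
  define f where "f i = c ! i" for i
  have bij: "bij_betw f {..<?n} W"
    unfolding f_def using bij_betw_nth[OF dc, of "{..<?n}" W] c(2) by auto
  define ix where "ix = the_inv_into {..<?n} f"
  have ixb: "bij_betw ix W {..<?n}" unfolding ix_def by (rule bij_betw_the_inv_into[OF bij])
  have f_ix: "f (ix w) = w" if "w \<in> W" for w
    unfolding ix_def using bij that by (meson f_the_inv_into_f_bij_betw)
  have ixlt: "ix w < ?n" if "w \<in> W" for w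
    using ixb that by (auto simp: bij_betw_def)
  have nxt: "bij_betw (\<lambda>i. Suc i mod ?n) {..<?n} {..<?n}"
  proof -
    have "inj_on (\<lambda>i. Suc i mod ?n) {..<?n}"
    proof (rule inj_onI)
      fix i j assume "i \<in> {..<?n}" "j \<in> {..<?n}" "Suc i mod ?n = Suc j mod ?n"
      then show "i = j" by (auto simp: mod_Suc split: if_splits)
    qed
    then show ?thesis
      by (intro bij_betw_imageI endo_inj_surj) (use n0 in auto)
  qed
  define s where "s = f \<circ> (\<lambda>i. Suc i mod ?n) \<circ> ix"
  have sb: "bij_betw s W W"
    unfolding s_def using ixb nxt bij by (auto intro!: bij_betw_trans)
  have last_rot: "last (rotate (Suc (ix w)) c) = w" and hd_rot: "hd (rotate (Suc (ix w)) c) = s w"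
    if "w \<in> W" for w
  proof -
    have "last (rotate (Suc (ix w)) c) = c ! ((Suc (ix w) + (?n - 1)) mod ?n)"
      using nc n0 by (simp add: last_conv_nth nth_rotate del: rotate_Suc)
    also have "(Suc (ix w) + (?n - 1)) mod ?n = ix w"
      using ixlt[OF that] n0 by simp
    finally show "last (rotate (Suc (ix w)) c) = w" using f_ix[OF that] by (simp add: f_def)
    show "hd (rotate (Suc (ix w)) c) = s w"
      using nc n0 by (simp add: hd_conv_nth nth_rotate s_def f_def del: rotate_Suc)
  qed
  have one: "\<exists>c. cyc_list adj c \<and> set c = W \<and> last c = w \<and> hd c = s w" if "w \<in> W" for w
    using last_rot[OF that] hd_rot[OF that] cyc_list_rotate[OF c(1), of "Suc (ix w)"] c(2)
    by (metis set_rotate)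
  have two: "\<exists>p q. p \<noteq> [] \<and> q \<noteq> [] \<and> cyc_list adj (p @ q) \<and> set (p @ q) = W
        \<and> last q = w \<and> hd p = s w \<and> last p = w' \<and> hd q = s w'"
    if w: "w \<in> W" "w' \<in> W" "w \<noteq> w'" for w w'
  proof -
    define r where "r = rotate (Suc (ix w)) c"
    have r: "cyc_list adj r" "set r = W" "last r = w" "hd r = s w" "distinct r"
      using last_rot[OF w(1)] hd_rot[OF w(1)] cyc_list_rotate[OF c(1), of "Suc (ix w)"] c(2) dc
      by (auto simp: r_def)
    obtain p0 q where pq: "r = p0 @ w' # q" using w(2) r(2) by (meson split_list)
    have qne: "q \<noteq> []" using r(3) pq w(3) by auto
    \<comment> \<open>both \<open>q @ p0 @ [w']\<close> and the rotation of \<open>c\<close> ending in \<open>w'\<close> are rotations of \<open>c\<close>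
      with the same last entry, so they are equal\<close>
    define m where "m = (Suc (ix w) + Suc (length p0)) mod ?n"
    have "q @ p0 @ [w'] = rotate (Suc (length p0)) r"
      using pq by (metis append.assoc append_Cons append_Nil length_append_singleton rotate_append)
    then have e1: "q @ p0 @ [w'] = rotate m c"
      unfolding r_def m_def by (metis add.commute rotate_rotate rotate_conv_mod)
    have mn: "m < ?n" using n0 by (simp add: m_def)
    have "hd q = hd (rotate m c)" using e1 qne by (metis hd_append2)
    also have "\<dots> = c ! m" using nc mn by (simp add: hd_conv_nth nth_rotate)
    finally have hq: "hd q = c ! m" .
    have "w' = last (rotate m c)" using e1 by (metis last_appendR last_snoc snoc_eq_iff_butlast)
    also have "\<dots> = c ! ((m + (?n - 1)) mod ?n)"
      using nc n0 by (simp add: last_conv_nth nth_rotate)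
    finally have "f (ix w') = f ((m + (?n - 1)) mod ?n)" using f_ix[OF w(2)] by (simp add: f_def)
    then have "ix w' = (m + (?n - 1)) mod ?n"
      using bij ixlt[OF w(2)] n0 by (auto simp: bij_betw_def inj_on_def)
    then have "Suc (ix w') mod ?n = m" using mn n0
      by (simp add: mod_Suc_eq)
    then have "hd q = s w'" by (simp add: s_def f_def hq)
    moreover have "hd (p0 @ [w']) = s w" using r(4) pq by (cases p0) auto
    ultimately show ?thesis
      using r pq qne by (intro exI[where x = q] exI[where x = "p0 @ [w']"]) auto
  qed
  show thesis by (rule that[OF sb one two])
qed

section \<open>Absorbing degenerate cycles\<close>

lemma partition_on_parts_eq:
  "partition_on V P \<Longrightarrow> A \<in> P \<Longrightarrow> B \<in> P \<Longrightarrow> x \<in> A \<Longrightarrow> x \<in> B \<Longrightarrow> A = B"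
  by (metis disjointD disjoint_iff partition_onD2)

lemma partition_on_disjoint_Un:
  assumes "partition_on A P" "partition_on B Q" "A \<inter> B = {}"
  shows "partition_on (A \<union> B) (P \<union> Q)"
  using assms unfolding partition_on_def by (auto intro!: disjoint_union)

lemma partition_on_replace:
  assumes P: "partition_on V P" and R: "R \<subseteq> P" and R': "partition_on (\<Union>R) R'"
  shows "partition_on V (P - R \<union> R')"
proof -
  have "partition_on (\<Union>(P - R) \<union> \<Union>R) (P - R \<union> R')"
  proof (rule partition_on_disjoint_Un[OF _ R'])
    show "\<Union>(P - R) \<inter> \<Union>R = {}"
      using partition_on_parts_eq[OF P] R by blast
    show "partition_on (\<Union>(P - R)) (P - R)"
      using P unfolding partition_on_def by (auto simp: disjoint_def)
  qed
  moreover have "\<Union>(P - R) \<union> \<Union>R = V" using P R by (auto simp: partition_on_def)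
  ultimately show ?thesis by simp
qed

context ugraph
begin

abbreviation nb :: "'a \<Rightarrow> 'a set" where "nb v \<equiv> {w. adj v w}"

lemma finite_nb [simp]: "finite (nb v)"
  by (rule finite_subset[OF _ finV]) (use adj_in in auto)

text \<open>
  The vertex \<open>v\<close> and the successors of its neighbours in \<open>N\<close> are too many to be independent. An edge
  from \<open>v\<close> to the successor of \<open>w\<close> lets \<open>v\<close> be inserted behind \<open>w\<close>. An edge between the successors of
  \<open>w\<close> and \<open>w'\<close> lets the cycles through \<open>w\<close> and \<open>w'\<close>, which may coincide, be cut behind these vertices
  and be joined to one cycle by this edge and the path from \<open>w\<close> to \<open>w'\<close> through \<open>v\<close>.
\<close>
lemma absorb_vertex:
  assumes P: "cyc_partition V adj P" and A: "A \<in> P" and v: "v \<in> A"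
    and N: "N \<subseteq> nb v - A"
    and alpha: "\<And>I. indep V adj I \<Longrightarrow> card I \<le> card N"
  shows "\<exists>Q. Q \<subseteq> P - {A} \<and> Q \<noteq> {} \<and> cyclable adj (insert v (\<Union>Q))"
proof -
  have part: "partition_on V P" and cyc: "\<And>W. W \<in> P \<Longrightarrow> cyclable adj W"
    using P by (auto simp: cyc_partition_def)
  have NV: "N \<subseteq> V" using N adj_in by blast
  have vV: "v \<in> V" using A v part by (auto simp: partition_on_def)
  obtain S where
    Sb: "\<And>W. W \<in> P \<Longrightarrow> bij_betw (S W) W W" and
    S1: "\<And>W w. W \<in> P \<Longrightarrow> w \<in> W \<Longrightarrow> \<exists>c. cyc_list adj c \<and> set c = W \<and> last c = w \<and> hd c = S W w" and
    S2: "\<And>W w w'. W \<in> P \<Longrightarrow> w \<in> W \<Longrightarrow> w' \<in> W \<Longrightarrow> w \<noteq> w' \<Longrightarrow>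
      \<exists>p q. p \<noteq> [] \<and> q \<noteq> [] \<and> cyc_list adj (p @ q) \<and> set (p @ q) = W
        \<and> last q = w \<and> hd p = S W w \<and> last p = w' \<and> hd q = S W w'"
  proof -
    have *: "\<forall>W\<in>P. \<exists>s. bij_betw s W W \<and>
        (\<forall>w\<in>W. \<exists>c. cyc_list adj c \<and> set c = W \<and> last c = w \<and> hd c = s w) \<and>
        (\<forall>w\<in>W. \<forall>w'\<in>W. w \<noteq> w' \<longrightarrow>
          (\<exists>p q. p \<noteq> [] \<and> q \<noteq> [] \<and> cyc_list adj (p @ q) \<and> set (p @ q) = W
            \<and> last q = w \<and> hd p = s w \<and> last p = w' \<and> hd q = s w'))"
      using cyclable_successor[OF cyc] by metis
    from bchoice[OF this] that show thesis by metis
  qed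
  have "\<forall>w\<in>V. \<exists>W\<in>P. w \<in> W" using part by (auto simp: partition_on_def)
  then obtain pt where pt: "\<And>w. w \<in> V \<Longrightarrow> pt w \<in> P \<and> w \<in> pt w" by metis
  define s where "s w = S (pt w) w" for w
  have s_in: "s w \<in> pt w" if "w \<in> V" for w
    using Sb pt that unfolding s_def bij_betw_def by blast
  have pt_eq: "pt w = W" if "w \<in> V" "W \<in> P" "w \<in> W" for w W
    using partition_on_parts_eq[OF part] pt that by blast
  have inj: "inj_on s N"
  proof (rule inj_onI)
    fix w w' assume w: "w \<in> N" "w' \<in> N" "s w = s w'"
    then have wV: "w \<in> V" "w' \<in> V" using NV by auto
    have eq: "pt w = pt w'"
      using partition_on_parts_eq[OF part] pt[OF wV(1)] pt[OF wV(2)] s_in[OF wV(1)] s_in[OF wV(2)] w(3)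
      by metis
    then show "w = w'"
      using Sb[of "pt w"] pt[OF wV(1)] pt[OF wV(2)] w(3) unfolding s_def bij_betw_def
      by (metis inj_onD)
  qed
  have ptA: "pt w \<in> P - {A}" if "w \<in> N" for w
    using pt NV N that by blast
  have vs: "v \<notin> s ` N"
  proof
    assume "v \<in> s ` N"
    then obtain w where w: "w \<in> N" "v = s w" by auto
    then have "v \<in> pt w" using s_in NV by auto
    then have "pt w = A" using partition_on_parts_eq[OF part] A v ptA[OF w(1)] by blast
    then show False using ptA[OF w(1)] by simp
  qed
  have finN: "finite N" using NV finV finite_subset by blast
  have sV: "s ` N \<subseteq> V" using s_in pt NV part unfolding partition_on_def by blast
  have "card (insert v (s ` N)) = card N + 1"
    using vs finN card_image[OF inj] by simp
  then have "\<not> indep V adj (insert v (s ` N))" using alpha by fastforce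
  then obtain a b where ab: "a \<in> insert v (s ` N)" "b \<in> insert v (s ` N)" "adj a b"
    using sV vV unfolding indep_def by blast
  have ndv: "v \<notin> W" if "W \<in> P - {A}" for W
    using partition_on_parts_eq[OF part] A v that by blast
  have insert_v: ?thesis if w: "w \<in> N" and va: "adj v (s w)" for w
  proof -
    have wV: "w \<in> V" using w NV by auto
    obtain c where c: "cyc_list adj c" "set c = pt w" "last c = w" "hd c = s w"
      using S1[of "pt w" w] pt[OF wV] s_def by auto
    have "cyc_list adj (v # c)"
      using c va N w ndv[OF ptA[OF w]] adj_sym
      by (auto simp: cyc_list_def successively_Cons)
    then have "cyclable adj (insert v (pt w))" using c(2) unfolding cyclable_def
      by (intro exI[of _ "v # c"]) auto
    then show ?thesis using ptA[OF w] by (intro exI[of _ "{pt w}"]) auto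
  qed
  have link_two: ?thesis if w: "w \<in> N" "w' \<in> N" and ss: "adj (s w) (s w')" for w w'
  proof -
    have wV: "w \<in> V" "w' \<in> V" using w NV by auto
    have ne: "w \<noteq> w'" using ss adj_irrefl by auto
    have vw: "adj v w" "adj v w'" using N w by auto
    show ?thesis
    proof (cases "pt w = pt w'")
      case True
      then obtain p q where pq: "p \<noteq> []" "q \<noteq> []" "cyc_list adj (p @ q)" "set (p @ q) = pt w"
         "last q = w" "hd p = s w" "last p = w'" "hd q = s w'"
        using S2[of "pt w" w w'] pt[OF wV(1)] pt[OF wV(2)] ne unfolding s_def by metis
      have "successively adj (rev q)"
        using pq(3) adj_sym by (auto simp: cyc_list_def successively_append_iff elim: successively_mono)
      then have "cyc_list adj (v # rev q @ p)"
        using pq vw ss adj_sym ndv[OF ptA[OF w(1)]]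
        by (auto simp: cyc_list_def successively_Cons successively_append_iff hd_append hd_rev last_rev)
      then have "cyclable adj (insert v (pt w))" using pq(4) unfolding cyclable_def
        by (intro exI[of _ "v # rev q @ p"]) auto
      then show ?thesis using ptA[OF w(1)] by (intro exI[of _ "{pt w}"]) auto
    next
      case False
      obtain c where c: "cyc_list adj c" "set c = pt w" "last c = w" "hd c = s w"
        using S1[of "pt w" w] pt[OF wV(1)] s_def by auto
      obtain c' where c': "cyc_list adj c'" "set c' = pt w'" "last c' = w'" "hd c' = s w'"
        using S1[of "pt w'" w'] pt[OF wV(2)] s_def by auto
      have dj: "pt w \<inter> pt w' = {}"
        using partition_on_parts_eq[OF part] False pt[OF wV(1)] pt[OF wV(2)] by blast
      have "successively adj (rev c)"
        using c(1) adj_sym by (auto simp: cyc_list_def elim: successively_mono)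
      then have "cyc_list adj (v # rev c @ c')"
        using c c' dj vw ss adj_sym ndv[OF ptA[OF w(1)]] ndv[OF ptA[OF w(2)]]
        by (auto simp: cyc_list_def successively_Cons successively_append_iff hd_append hd_rev last_rev)
      then have "cyclable adj (insert v (pt w \<union> pt w'))" using c(2) c'(2) unfolding cyclable_def
        by (intro exI[of _ "v # rev c @ c'"]) auto
      then show ?thesis using ptA[OF w(1)] ptA[OF w(2)]
        by (intro exI[of _ "{pt w, pt w'}"]) auto
    qed
  qed
  consider w where "a = v" "b = s w" "w \<in> N" | w where "b = v" "a = s w" "w \<in> N"
    | w w' where "a = s w" "b = s w'" "w \<in> N" "w' \<in> N"
    using ab adj_irrefl by auto
  then show ?thesis
  proof cases
    case 1 then show ?thesis using insert_v ab(3) by simp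
  next
    case 2 then show ?thesis using insert_v adj_sym[OF ab(3)] by simp
  next
    case 3 then show ?thesis using link_two ab(3) by simp
  qed
qed

lemma cyc_partition_replace:
  assumes P: "cyc_partition V adj P" and R: "R \<subseteq> P" and R': "partition_on (\<Union>R) R'"
    and cyc: "\<And>W. W \<in> R' \<Longrightarrow> cyclable adj W"
  shows "cyc_partition V adj (P - R \<union> R')"
  using partition_on_replace[OF _ R R'] P cyc by (auto simp: cyc_partition_def)

lemma finite_cyc_partition: "cyc_partition V adj P \<Longrightarrow> finite P"
  using finV finite_elements by (auto simp: cyc_partition_def)

text \<open>
  Absorbing a single vertex saves a part. Absorbing one end of a degenerate cycle with two vertices
  leaves the other end as a single vertex, without increasing the number of parts, so this case
  reduces to the first one.
\<close>
lemma minimal_cyc_partition_no_small_parts: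
  assumes P: "cyc_partition V adj P"
    and minimal: "\<And>P'. cyc_partition V adj P' \<Longrightarrow> card P \<le> card P'"
    and alpha: "\<And>I. indep V adj I \<Longrightarrow> card I \<le> a"
    and deg: "\<And>v. v \<in> V \<Longrightarrow> a + 1 \<le> card (nb v)"
    and W: "W \<in> P"
  shows "card W \<ge> 3"
proof -
  have no_single: False
    if P: "cyc_partition V adj P" and minimal: "\<And>P'. cyc_partition V adj P' \<Longrightarrow> card P \<le> card P'"
      and W: "{v} \<in> P" for P v
  proof -
    have part: "partition_on V P" using P by (simp add: cyc_partition_def)
    have fP: "finite P" using finite_cyc_partition[OF P] .
    have "v \<in> V" using W part by (auto simp: partition_on_def)
    have sub: "nb v \<subseteq> nb v - {v}" using adj_irrefl by auto
    have "card I \<le> card (nb v)" if "indep V adj I" for I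
      using alpha[OF that] deg[OF \<open>v \<in> V\<close>] by linarith
    from absorb_vertex[OF P W _ sub this]
    obtain Q where Q: "Q \<subseteq> P - {{v}}" "Q \<noteq> {}" "cyclable adj (insert v (\<Union>Q))"
      by auto
    let ?P' = "P - insert {v} Q \<union> {insert v (\<Union>Q)}"
    have "cyc_partition V adj ?P'"
      by (rule cyc_partition_replace[OF P]) (use W Q in \<open>auto simp: partition_on_def\<close>)
    then have "card P \<le> card ?P'" by (rule minimal)
    also have "\<dots> \<le> card (P - insert {v} Q) + 1"
      using card_Un_le[of "P - insert {v} Q" "{insert v (\<Union>Q)}"] by simp
    also have "card (P - insert {v} Q) = card P - card (insert {v} Q)"
      by (rule card_Diff_subset) (use Q W fP finite_subset in auto)
    also have "card (insert {v} Q) \<ge> 2"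
    proof -
      have "finite Q" using Q fP finite_subset by blast
      moreover have "{v} \<notin> Q" using Q by auto
      moreover have "card Q > 0" using Q(2) \<open>finite Q\<close> by (simp add: card_gt_0_iff)
      ultimately show ?thesis by simp
    qed
    moreover have "card (insert {v} Q) \<le> card P" by (rule card_mono) (use fP Q W in auto)
    ultimately show False by linarith
  qed
  have part: "partition_on V P" using P by (simp add: cyc_partition_def)
  have fP: "finite P" using finite_cyc_partition[OF P] .
  have fW: "finite W"
    using W part by (intro finite_subset[OF _ finV]) (auto simp: partition_on_def)
  have "card W \<noteq> 0" using W part fW by (auto simp: partition_on_def)
  moreover have "card W \<noteq> 1" using no_single[OF P minimal] W by (auto simp: card_1_singleton_iff)
  moreover have "card W \<noteq> 2"
  proof
    assume "card W = 2"
    then obtain u v where uv: "W = {u, v}" "u \<noteq> v" by (auto simp: card_2_iff)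
    then have "v \<in> V" using W part by (auto simp: partition_on_def)
    have "a \<le> card (nb v - W)"
    proof -
      have "nb v - W = nb v - {u}" using uv adj_irrefl by auto
      then show ?thesis using deg[OF \<open>v \<in> V\<close>] card_Diff1_le[of "nb v" u]
        by (simp add: card_Diff_singleton_if split: if_splits)
    qed
    then have "card I \<le> card (nb v - W)" if "indep V adj I" for I
      using alpha[OF that] by linarith
    from absorb_vertex[OF P W _ subset_refl this]
    obtain Q where Q: "Q \<subseteq> P - {W}" "Q \<noteq> {}" "cyclable adj (insert v (\<Union>Q))"
      using uv by auto
    let ?P' = "P - insert W Q \<union> {insert v (\<Union>Q), {u}}"
    have uQ: "u \<notin> \<Union>Q" using Q(1) partition_on_parts_eq[OF part _ W] uv by blast
    have P': "cyc_partition V adj ?P'"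
    proof (rule cyc_partition_replace[OF P])
      have "\<Union>(insert W Q) = insert v (\<Union>Q) \<union> {u}" using uv by auto
      moreover have "partition_on (insert v (\<Union>Q) \<union> {u}) ({insert v (\<Union>Q)} \<union> {{u}})"
        by (intro partition_on_disjoint_Un partition_on_space) (use uQ uv in auto)
      ultimately show "partition_on (\<Union>(insert W Q)) {insert v (\<Union>Q), {u}}"
        by (simp add: insert_commute)
    qed (use W Q in \<open>auto simp: cyclable_singleton\<close>)
    have "card ?P' \<le> card (P - insert W Q) + card {insert v (\<Union>Q), {u}}"
      by (rule card_Un_le)
    also have "\<dots> \<le> card (P - insert W Q) + 2"
      using card_insert_le_m1[of 2 "{{u}}" "insert v (\<Union>Q)"] by simp
    also have "card (P - insert W Q) = card P - card (insert W Q)"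
      by (rule card_Diff_subset) (use Q W fP finite_subset in auto)
    also have "card (insert W Q) \<ge> 2"
    proof -
      have "finite Q" using Q fP finite_subset by blast
      moreover have "W \<notin> Q" using Q by auto
      moreover have "card Q > 0" using Q(2) \<open>finite Q\<close> by (simp add: card_gt_0_iff)
      ultimately show ?thesis by simp
    qed
    moreover have "card (insert W Q) \<le> card P" by (rule card_mono) (use fP Q W in auto)
    ultimately have "card ?P' \<le> card P" by linarith
    then show False using no_single[OF P'] minimal by (meson UnI2 insertI1 insertI2 le_trans)
  qed
  ultimately show ?thesis by linarith
qed

end

section \<open>Local completion of claw-free graphs\<close>

locale claw_free_ugraph = ugraph +
  assumes no_claw: "\<lbrakk>adj v p; adj v q; adj v r; p \<noteq> q; p \<noteq> r; q \<noteq> r\<rbrakk> \<Longrightarrow> adj p q \<or> adj p r \<or> adj q r"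

definition local_completion :: "('a \<Rightarrow> 'a \<Rightarrow> bool) \<Rightarrow> 'a \<Rightarrow> 'a \<Rightarrow> 'a \<Rightarrow> bool" where
  "local_completion adj x u w \<longleftrightarrow> adj u w \<or> (u \<noteq> w \<and> adj x u \<and> adj x w)"

lemma (in ugraph) ugraph_local_completion: "ugraph V (local_completion adj x)"
  using finV adj_in adj_sym adj_irrefl
  by unfold_locales (auto simp: local_completion_def)

text \<open>
  A claw has at most two vertices in the completed neighbourhood. If its centre and one leaf are
  there, this leaf can be replaced by \<open>x\<close>, which gives a claw of the original graph.
\<close>
lemma (in claw_free_ugraph) claw_free_local_completion:
  "claw_free_ugraph V (local_completion adj x)"
proof -
  let ?a = "local_completion adj x"
  interpret L: ugraph V ?a by (rule ugraph_local_completion)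
  define K where "K = insert x (nb x)"
  have inK: "?a u w" if "u \<in> K" "w \<in> K" "u \<noteq> w" for u w
    using that adj_sym unfolding K_def local_completion_def by auto
  have outK: "adj u w" if "?a u w" "u \<notin> K \<or> w \<notin> K" for u w
    using that unfolding K_def local_completion_def by auto
  have sup: "?a u w" if "adj u w" for u w using that by (simp add: local_completion_def)
  \<comment> \<open>two neighbours outside \<open>K\<close> of a vertex in \<open>K\<close> are adjacent, as \<open>x\<close> would complete them to a
    claw\<close>
  have two: "adj q r" if v: "v \<in> K" "q \<notin> K" "r \<notin> K" "q \<noteq> r" "?a v q" "?a v r" for v q r
  proof -
    have vq: "adj v q" and vr: "adj v r" using v outK by auto
    have "v \<noteq> x" using vq v(2) by (auto simp: K_def)
    then have "adj v x" using v(1) adj_sym by (auto simp: K_def)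
    then show ?thesis using no_claw[of v x q r] vq vr v by (auto simp: K_def)
  qed
  have "?a p q \<or> ?a p r \<or> ?a q r"
    if c: "?a v p" "?a v q" "?a v r" "p \<noteq> q" "p \<noteq> r" "q \<noteq> r" for v p q r
  proof (cases "v \<in> K")
    case False
    then have "adj v p" "adj v q" "adj v r" using c outK by auto
    then show ?thesis using no_claw[of v p q r] c sup by blast
  next
    case True
    show ?thesis
    proof (cases "p \<in> K")
      case pK: True
      then show ?thesis using two[OF True, of q r] c inK[of p q] inK[of p r] sup by blast
    next
      case pK: False
      then show ?thesis using two[OF True, of p q] two[OF True, of p r] c inK[of q r] sup by blast
    qed
  qed
  then show ?thesis by unfold_locales blast
qed

text \<open>
  The pieces into which a cycle falls when its edges inside \<open>K\<close> are removed, provided that each vertex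
  of the cycle in \<open>K\<close> has a neighbour on the cycle in \<open>K\<close>. Only the ends of a segment are in \<open>K\<close>.
\<close>

definition segment :: "('a \<Rightarrow> 'a \<Rightarrow> bool) \<Rightarrow> 'a set \<Rightarrow> 'a list \<Rightarrow> bool" where
  "segment adj K p \<longleftrightarrow> distinct p \<and> successively adj p \<and>
     (\<exists>a\<in>K. p = [a] \<or> (\<exists>b\<in>K. \<exists>q. p = a # q @ [b] \<and> q \<noteq> [] \<and> set q \<inter> K = {}))"

lemma segment_ends:
  assumes "segment adj K p"
  shows "p \<noteq> []" "hd p \<in> K" "last p \<in> K" "v \<in> set p \<Longrightarrow> v \<in> K \<Longrightarrow> v = hd p \<or> v = last p"
  using assms unfolding segment_def by auto

lemma (in ugraph) segment_rev: "segment adj K p \<Longrightarrow> segment adj K (rev p)"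
proof -
  assume p: "segment adj K p"
  then have "distinct (rev p)" "successively adj (rev p)"
    using adj_sym by (auto simp: segment_def elim: successively_mono)
  moreover have "\<exists>a\<in>K. rev p = [a] \<or> (\<exists>b\<in>K. \<exists>q. rev p = a # q @ [b] \<and> q \<noteq> [] \<and> set q \<inter> K = {})"
  proof -
    obtain a where a: "a \<in> K"
      and c: "p = [a] \<or> (\<exists>b\<in>K. \<exists>q. p = a # q @ [b] \<and> q \<noteq> [] \<and> set q \<inter> K = {})"
      using p by (auto simp: segment_def)
    from c show ?thesis
    proof (elim disjE bexE exE conjE)
      fix b q assume "b \<in> K" "p = a # q @ [b]" "q \<noteq> []" "set q \<inter> K = {}"
      then show ?thesis using a by (intro bexI[of _ b] disjI2 bexI[of _ a] exI[of _ "rev q"]) auto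
    qed (use a in auto)
  qed
  ultimately show ?thesis by (simp add: segment_def)
qed

lemma concat_path:
  assumes "us \<noteq> []" "\<And>u. u \<in> set us \<Longrightarrow> u \<noteq> [] \<and> successively adj u"
    "successively (\<lambda>u u'. adj (last u) (hd u')) us"
  shows "concat us \<noteq> [] \<and> successively adj (concat us)
    \<and> hd (concat us) = hd (hd us) \<and> last (concat us) = last (last us)"
  using assms
proof (induction us)
  case (Cons u us)
  show ?case
  proof (cases "us = []")
    case False
    then show ?thesis using Cons by (auto simp: successively_Cons successively_append_iff)
  qed (use Cons in auto)
qed simp

context claw_free_ugraph
begin

text \<open>
  The neighbours \<open>c\<close> and \<open>d\<close> of \<open>x\<close> lie in one component of the neighbourhood, because of \<open>b\<close>. A
  vertex of another component would form a claw at \<open>x\<close> together with them.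
\<close>
lemma nb_connected:
  assumes diamond: "adj x b" "adj x c" "adj x d" "adj b c" "adj b d" "c \<noteq> d" "\<not> adj c d"
    and XY: "X \<union> Y = nb x" "X \<inter> Y = {}" "X \<noteq> {}" "Y \<noteq> {}"
  shows "\<exists>v\<in>X. \<exists>y\<in>Y. adj v y"
proof (rule ccontr)
  assume no: "\<not> ?thesis"
  have mem: "b \<in> X \<union> Y" "c \<in> X \<union> Y" "d \<in> X \<union> Y" using diamond XY by auto
  have same: "(b \<in> X \<and> c \<in> X \<and> d \<in> X) \<or> (b \<in> Y \<and> c \<in> Y \<and> d \<in> Y)"
    using mem no diamond adj_sym by blast
  have claw: False if "y \<in> nb x" "y \<noteq> c" "y \<noteq> d" "\<not> adj c y" "\<not> adj d y" for y
    using no_claw[of x c d y] diamond that by auto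
  from same show False
  proof
    assume s: "b \<in> X \<and> c \<in> X \<and> d \<in> X"
    obtain y where "y \<in> Y" using XY by auto
    then show False using claw[of y] s no XY by blast
  next
    assume s: "b \<in> Y \<and> c \<in> Y \<and> d \<in> Y"
    obtain y where "y \<in> X" using XY by auto
    then show False using claw[of y] s no XY adj_sym by blast
  qed
qed

text \<open>
  A longest chain of segments, linked by edges between neighbours of \<open>x\<close>, contains all of them.
  Otherwise its two ends are adjacent, because \<open>x\<close>, these ends and an end of an unused segment do not
  form a claw. So the chain can be closed and reopened next to any neighbour of \<open>x\<close> on it, in
  particular at one that is adjacent to an unused segment.
\<close>
lemma join_segments:
  assumes diamond: "adj x b" "adj x c" "adj x d" "adj b c" "adj b d" "c \<noteq> d" "\<not> adj c d"
    and fin: "finite \<S>" and ne: "\<S> \<noteq> {}" and disj: "disjoint \<S>"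
    and seg: "\<And>R. R \<in> \<S> \<Longrightarrow> \<exists>p. segment adj (nb x) p \<and> set p = R"
    and cov: "nb x \<subseteq> \<Union>\<S>"
  shows "\<exists>p. p \<noteq> [] \<and> distinct p \<and> successively adj p \<and> set p = \<Union>\<S>
    \<and> hd p \<in> nb x \<and> last p \<in> nb x"
proof -
  let ?lk = "\<lambda>u u'. adj (last u) (hd u')"
  define good where "good us \<longleftrightarrow> us \<noteq> [] \<and> (\<forall>u\<in>set us. segment adj (nb x) u \<and> set u \<in> \<S>)
    \<and> distinct (map set us) \<and> successively ?lk us" for us
  obtain R where R: "R \<in> \<S>" using ne by auto
  then obtain p where p: "segment adj (nb x) p" "set p = R" using seg by blast
  have g0: "good [p]" using p R by (simp add: good_def)
  have bound: "length us < Suc (card \<S>)" if "good us" for us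
  proof -
    have "set (map set us) \<subseteq> \<S>" using that by (auto simp: good_def)
    then have "card (set (map set us)) \<le> card \<S>" using fin card_mono by blast
    then show ?thesis using that distinct_card[of "map set us"] by (simp add: good_def)
  qed
  obtain us where us: "good us" and max: "\<And>vs. good vs \<Longrightarrow> length vs \<le> length us"
    using ex_has_greatest_nat[of good "[p]" length "Suc (card \<S>)"] g0 bound by blast
  have usne: "us \<noteq> []" and usseg: "\<And>u. u \<in> set us \<Longrightarrow> segment adj (nb x) u \<and> set u \<in> \<S>"
    using us by (auto simp: good_def)
  \<comment> \<open>a longest chain of segments cannot be prolonged at its end, nor at the end of any
    reordering of it\<close>
  have no_append: "\<not> adj (last (last vs)) (hd r)"
    if "good vs" "length vs = length us" "segment adj (nb x) r" "set r \<in> \<S>" "set r \<notin> set ` set vs"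
    for vs r
  proof
    assume "adj (last (last vs)) (hd r)"
    then have "good (vs @ [r])" using that by (auto simp: good_def successively_append_iff)
    then show False using max[of "vs @ [r]"] that by simp
  qed
  have no_prepend: "\<not> adj (last r) (hd (hd vs))"
    if "good vs" "length vs = length us" "segment adj (nb x) r" "set r \<in> \<S>" "set r \<notin> set ` set vs"
    for vs r
  proof
    assume "adj (last r) (hd (hd vs))"
    then have "good (r # vs)" using that by (auto simp: good_def successively_Cons)
    then show False using max[of "r # vs"] that by simp
  qed
  have all: "set ` set us = \<S>"
  proof (rule ccontr)
    assume "set ` set us \<noteq> \<S>"
    then obtain R where R: "R \<in> \<S>" "R \<notin> set ` set us" using usseg by blast
    obtain r where r: "segment adj (nb x) r" "set r = R" using seg[OF R(1)] by blast
    define X where "X = nb x \<inter> \<Union>(set ` set us)"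
    define pp where "pp = hd (hd us)"
    define qq where "qq = last (last us)"
    have hdu: "hd us \<in> set us" and lu: "last us \<in> set us" using usne by auto
    have ppX: "pp \<in> X"
      using segment_ends[of adj "nb x" "hd us"] usseg[OF hdu] hdu hd_in_set
      unfolding X_def pp_def by auto
    have qqX: "qq \<in> X"
      using segment_ends[of adj "nb x" "last us"] usseg[OF lu] lu last_in_set
      unfolding X_def qq_def by auto
    have outside: "a \<notin> X" if "a \<in> R'" "R' \<in> \<S>" "R' \<notin> set ` set us" for a R'
      using that disj usseg unfolding X_def disjoint_def by blast
    have ra: "hd r \<in> nb x" "hd r \<in> R" using segment_ends[OF r(1)] r(2) by auto
    have neY: "nb x - X \<noteq> {}" using ra outside R by blast
    have XN: "X \<subseteq> nb x" by (auto simp: X_def)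
    have "\<exists>v\<in>X. \<exists>y\<in>nb x - X. adj v y"
      by (rule nb_connected[OF diamond]) (use ppX neY XN in auto)
    then obtain v y where vy: "v \<in> X" "y \<in> nb x - X" "adj v y" by blast
    have "y \<in> nb x" "y \<notin> \<Union>(set ` set us)" using vy(2) unfolding X_def by simp_all
    then obtain R' where R': "R' \<in> \<S>" "y \<in> R'" "R' \<notin> set ` set us"
      using subsetD[OF cov] by (meson UnionE UnionI)
    obtain r0 where r0: "segment adj (nb x) r0" "set r0 = R'" using seg[OF R'(1)] by blast
    have y0: "y = hd r0 \<or> y = last r0" using segment_ends(4)[OF r0(1)] r0(2) R'(2) vy(2) by auto
    obtain r1 where r1: "segment adj (nb x) r1" "set r1 = R'" "hd r1 = y"
      using y0 r0 segment_rev[OF r0(1)] segment_ends(1)[OF r0(1)]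
      by (metis hd_rev set_rev)
    define r2 where "r2 = rev r1"
    have r2: "segment adj (nb x) r2" "set r2 = R'" "last r2 = y"
      using r1 segment_rev segment_ends(1)[OF r1(1)] by (auto simp: r2_def last_rev)
    have nqy: "\<not> adj qq y" using no_append[OF us refl r1(1)] r1 R' by (simp add: qq_def)
    have npy: "\<not> adj pp y" using no_prepend[OF us refl r2(1)] r2 R' adj_sym by (auto simp: pp_def)
    \<comment> \<open>hence the chain is a single vertex, or it can be closed to a cycle and reopened at \<open>v\<close>\<close>
    have closed: "pp = qq \<or> adj qq pp"
      using no_claw[of x pp qq y] ppX qqX vy nqy npy adj_sym by (auto simp: X_def)
    obtain u where u: "u \<in> set us" "v \<in> set u" using vy(1) by (auto simp: X_def)
    have vu: "v = hd u \<or> v = last u"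
      using segment_ends(4)[of adj "nb x" u v] usseg[OF u(1)] u(2) vy(1) by (auto simp: X_def)
    obtain us1 us2 where split: "us = us1 @ u # us2" using u(1) by (meson split_list)
    have rot: "good (bs @ as)" "length (bs @ as) = length us" if "us = as @ bs" "adj qq pp" for as bs
    proof -
      show "good (bs @ as)"
        using us that usne unfolding good_def pp_def qq_def
        by (cases "as = []"; cases "bs = []") (auto simp: successively_append_iff)
    qed (use that in simp)
    show False
    proof (cases "adj qq pp")
      case True
      from vu show False
      proof
        assume "v = last u"
        then show False
          using no_append[OF rot[of "us1 @ [u]" us2] r1(1)] True r1 R' vy split by auto
      next
        assume "v = hd u"
        moreover have "hd (hd ((u # us2) @ us1)) = hd u" by simp
        ultimately show False
          using no_prepend[OF rot[of us1 "u # us2"] r2(1)] True r2 R' vy split adj_sym by auto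
      qed
    next
      case False
      then have pq: "pp = qq" using closed by auto
      have "length us = 1"
      proof (rule ccontr)
        assume "length us \<noteq> 1"
        then obtain a as where as: "us = a # as" "as \<noteq> []" using usne by (cases us) auto
        then have "a \<noteq> []" "last as \<noteq> []"
          using segment_ends(1)[of adj "nb x"] usseg by auto
        then have "pp \<in> set a" "qq \<in> set (last as)"
          using as by (auto simp: pp_def qq_def)
        moreover have "set a \<noteq> set (last as)" using us as by (auto simp: good_def)
        moreover have "set a \<in> \<S>" "set (last as) \<in> \<S>" using usseg as by auto
        ultimately show False using pq disj unfolding disjoint_def by blast
      qed
      then have "us = [u]" using split by auto
      then have "v = pp" using pq vu by (auto simp: pp_def qq_def)
      then show False using npy vy by simp
    qed
  qed
  have path: "concat us \<noteq> [] \<and> successively adj (concat us)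
    \<and> hd (concat us) = hd (hd us) \<and> last (concat us) = last (last us)"
    by (rule concat_path) (use us usne segment_ends(1) in \<open>auto simp: good_def segment_def\<close>)
  moreover have "set (concat us) = \<Union>\<S>" using all by auto
  moreover have "distinct (concat us)"
  proof (rule distinct_concat)
    show "distinct us" using us by (auto simp: good_def distinct_map)
    show "distinct u" if "u \<in> set us" for u using usseg[OF that] by (simp add: segment_def)
    fix u w assume uw: "u \<in> set us" "w \<in> set us" "u \<noteq> w"
    then have "set u \<noteq> set w" using us by (auto simp: good_def distinct_map inj_on_def)
    then show "set u \<inter> set w = {}" using usseg uw disj unfolding disjoint_def by blast
  qed
  moreover have "hd (hd us) \<in> nb x" "last (last us) \<in> nb x"
    using segment_ends(2)[of adj "nb x" "hd us"] segment_ends(3)[of adj "nb x" "last us"]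
      usseg[of "hd us"] usseg[of "last us"] usne by auto
  ultimately show ?thesis by metis
qed


text \<open>
  A path or cycle of the local completion is cut at its edges inside \<open>K\<close>. A vertex of \<open>K\<close> none of
  whose two neighbours on the path lies in \<open>K\<close> becomes a segment of its own: as it also sees \<open>x\<close>,
  claw-freeness makes these two neighbours adjacent, so the path can skip it.
\<close>
lemma path_into_segments:
  assumes K: "K = insert x (nb x)"
  shows "\<lbrakk>successively (local_completion adj x) p; distinct p; p \<noteq> []; hd p \<in> K; last p \<in> K\<rbrakk>
    \<Longrightarrow> \<exists>\<S>. partition_on (set p) \<S> \<and> (\<forall>R\<in>\<S>. \<exists>q. segment adj K q \<and> set q = R)"
proof (induction "length p" arbitrary: p rule: less_induct)
  case less
  let ?a = "local_completion adj x"
  have outK: "adj u w" if "?a u w" "u \<notin> K \<or> w \<notin> K" for u w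
    using that unfolding K local_completion_def by auto
  have single: "segment adj K [a]" if "a \<in> K" for a using that by (simp add: segment_def)
  have add_part: ?case
    if h: "set p = A \<union> set r" "A \<inter> set r = {}" "segment adj K q" "set q = A" "length r < length p"
      "successively ?a r" "distinct r" "r \<noteq> []" "hd r \<in> K" "last r \<in> K" for A r q
  proof -
    obtain \<S> where S: "partition_on (set r) \<S>" "\<forall>R\<in>\<S>. \<exists>q. segment adj K q \<and> set q = R"
      using less.hyps[of r] h by blast
    have "A \<noteq> {}" using h segment_ends(1)[of adj K q] by auto
    then have "partition_on (A \<union> set r) ({A} \<union> \<S>)"
      using h S(1) by (intro partition_on_disjoint_Un partition_on_space) auto
    then show ?thesis using h S(2) by (intro exI[of _ "{A} \<union> \<S>"]) auto
  qed
  obtain a p1 where p: "p = a # p1" using less.prems by (cases p) auto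
  have aK: "a \<in> K" using less.prems p by simp
  show ?case
  proof (cases "p1 = []")
    case True
    then show ?thesis using p single[OF aK]
      by (intro exI[of _ "{{a}}"]) (auto simp: partition_on_def intro: exI[of _ "[a]"])
  next
    case False
    show ?thesis
    proof (cases "hd p1 \<in> K")
      case True
      show ?thesis
        by (rule add_part[of "{a}" p1 "[a]"])
          (use p False True less.prems single[OF aK] in \<open>auto simp: successively_Cons\<close>)
    next
      case bK: False
      have "last p1 \<in> K" using less.prems p False by simp
      then have "\<exists>c\<in>set p1. c \<in> K" using last_in_set[OF False] by blast
      from split_list_first_prop[OF this]
      obtain q c rest where q: "p1 = q @ c # rest" "c \<in> K" "\<forall>z\<in>set q. z \<notin> K" by blast
      have qne: "q \<noteq> []" using bK q by auto
      have succ: "adj a (hd q)" "successively adj q" "adj (last q) c"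
      proof -
        have s: "?a a (hd q)" "successively ?a q" "?a (last q) c"
          using less.prems(1) p q(1) qne
          by (auto simp: successively_Cons successively_append_iff)
        then show "adj a (hd q)" "adj (last q) c"
          using outK q(3) qne by auto
        show "successively adj q" using s(2) by (rule successively_mono) (use outK q(3) in auto)
      qed
      have seg: "segment adj K (a # q @ [c])"
        unfolding segment_def using succ q aK qne less.prems(2) p
        by (auto simp: successively_Cons successively_append_iff)
      show ?thesis
      proof (cases "rest = []")
        case True
        then show ?thesis using p q seg
          by (intro exI[of _ "{set p}"]) (auto simp: partition_on_def intro: exI[of _ "a # q @ [c]"])
      next
        case rne: False
        have sr: "successively ?a rest" "?a c (hd rest)"
          using less.prems(1) p q(1) rne by (auto simp: successively_Cons successively_append_iff)
        show ?thesis
        proof (cases "hd rest \<in> K")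
          case True
          show ?thesis
            by (rule add_part[OF _ _ seg, of _ rest])
              (use p q rne True less.prems sr in auto)
        next
          case dK: False
          have cd: "adj c (hd rest)" using outK[OF sr(2)] dK by auto
          have "c \<noteq> x" using cd dK by (auto simp: K)
          then have cx: "adj c x" using q(2) adj_sym by (auto simp: K)
          have lq: "last q \<notin> K" using q(3) qne by auto
          have "last q \<noteq> hd rest" using less.prems(2) p q(1) qne rne
            by (auto simp: disjoint_iff) (metis hd_in_set last_in_set)
          then have ld: "adj (last q) (hd rest)"
            using no_claw[of c "last q" "hd rest" x] adj_sym[OF succ(3)] cd cx lq dK adj_sym
            by (auto simp: K)
          have "successively ?a (a # q @ rest)"
            using less.prems(1) p q(1) qne rne ld sr
            by (auto simp: successively_Cons successively_append_iff local_completion_def)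
          then show ?thesis
            by (intro add_part[OF _ _ single[OF q(2)], of "{c}" "a # q @ rest"])
              (use p q rne less.prems aK in auto)
        qed
      qed
    qed
  qed
qed

text \<open>
  A cycle that is a single vertex of \<open>K\<close> or has an edge inside \<open>K\<close> is cut completely. From any other
  cycle the vertices of \<open>K\<close> are removed one after the other, and the remaining cycle \<open>W0\<close>, if there is
  one, avoids \<open>K\<close>. The vertex \<open>x\<close> cannot be on a cycle of the second kind as all its neighbours are in
  \<open>K\<close>.
\<close>
lemma cycle_into_segments:
  assumes K: "K = insert x (nb x)"
  shows "cyclable (local_completion adj x) W \<Longrightarrow> finite W \<Longrightarrow>
    \<exists>W0 \<S>. W0 \<subseteq> W \<and> W0 \<inter> K = {} \<and> (W0 = {} \<or> cyclable adj W0) \<and> (x \<in> W \<longrightarrow> W0 = {}) \<and>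
      partition_on (W - W0) \<S> \<and> (\<forall>R\<in>\<S>. \<exists>q. segment adj K q \<and> set q = R)"
proof (induction "card W" arbitrary: W rule: less_induct)
  case less
  let ?a = "local_completion adj x"
  have outK: "adj u w" if "?a u w" "u \<notin> K \<or> w \<notin> K" for u w
    using that unfolding K local_completion_def by auto
  show ?case
  proof (cases "W \<inter> K = {}")
    case True
    obtain c where c: "cyc_list ?a c" "set c = W" using less.prems by (auto simp: cyclable_def)
    have "successively adj c"
    proof (rule successively_mono)
      show "successively ?a c" using c by (simp add: cyc_list_def)
      show "adj u w" if "u \<in> set c" "w \<in> set c" "?a u w" for u w
        using that outK c(2) True by blast
    qed
    moreover have "length c = 1 \<or> adj (last c) (hd c)"
      using c True outK unfolding cyc_list_def by (metis disjoint_iff last_in_set)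
    ultimately have "cyclable adj W" using c unfolding cyclable_def cyc_list_def by blast
    then show ?thesis using True K by (intro exI[of _ W] exI[of _ "{}"]) (auto simp: partition_on_empty)
  next
    case False
    then obtain v where v: "v \<in> W" "v \<in> K" by auto
    obtain c where c: "cyc_list ?a c" "set c = W" using less.prems by (auto simp: cyclable_def)
    obtain r where r: "cyc_list ?a (v # r)" "set (v # r) = W"
      using cyc_list_at[OF c(1)] v c(2) by metis
    have whole: ?thesis if d: "cyc_list ?a d" "set d = W" "hd d \<in> K" "last d \<in> K" for d
    proof -
      obtain \<S> where "partition_on (set d) \<S>" "\<forall>R\<in>\<S>. \<exists>q. segment adj K q \<and> set q = R"
        using path_into_segments[OF K, of d] d by (auto simp: cyc_list_def)
      then show ?thesis using d by (intro exI[of _ "{}"] exI[of _ \<S>]) auto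
    qed
    show ?thesis
    proof (cases "last (v # r) \<in> K")
      case True then show ?thesis using whole[OF r] v by simp
    next
      case lK: False
      then have rne: "r \<noteq> []" using v by auto
      show ?thesis
      proof (cases "hd r \<in> K")
        case True
        have "cyc_list ?a (r @ [v])" using cyc_list_append_swap[of ?a "[v]" r] r(1) by simp
        then show ?thesis using whole[of "r @ [v]"] r(2) True v rne by auto
      next
        case hK: False
        have e: "?a v (hd r)" "?a (last r) v" "successively ?a r" "distinct r" "v \<notin> set r"
          using r(1) rne by (auto simp: cyc_list_def successively_Cons)
        have e': "adj v (hd r)" "adj (last r) v" using outK e hK lK rne by auto
        have vx: "v \<noteq> x" using e'(1) hK by (auto simp: K)
        then have "adj v x" using v adj_sym by (auto simp: K)
        moreover have "hd r \<noteq> last r \<longrightarrow> adj (last r) (hd r)"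
          using no_claw[of v "hd r" "last r" x] e' hK lK rne adj_sym calculation
          by (auto simp: K)
        moreover have "hd r = last r \<Longrightarrow> length r = 1"
          using e(4) rne by (cases r) (auto split: if_splits)
        ultimately have cr: "cyclable ?a (W - {v})"
          using e rne r(2) unfolding cyclable_def cyc_list_def
          by (intro exI[of _ r]) (auto simp: local_completion_def)
        have "card (W - {v}) < card W" using less.prems(2) v(1) by (rule card_Diff1_less)
        from less.hyps[OF this cr] less.prems(2)
        obtain W0 \<S> where IH: "W0 \<subseteq> W - {v}" "W0 \<inter> K = {}" "W0 = {} \<or> cyclable adj W0"
           "x \<in> W - {v} \<longrightarrow> W0 = {}" "partition_on (W - {v} - W0) \<S>"
           "\<forall>R\<in>\<S>. \<exists>q. segment adj K q \<and> set q = R" by auto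
        have "partition_on ({v} \<union> (W - {v} - W0)) ({{v}} \<union> \<S>)"
          by (intro partition_on_disjoint_Un partition_on_space IH(5)) auto
        moreover have "{v} \<union> (W - {v} - W0) = W - W0" using IH(1) v(1) by auto
        moreover have "segment adj K [v]" using v by (simp add: segment_def)
        ultimately show ?thesis using IH vx
          by (intro exI[of _ W0] exI[of _ "{{v}} \<union> \<S>"]) (auto intro: exI[of _ "[v]"])
      qed
    qed
  qed
qed

end

context claw_free_ugraph
begin

text \<open>
  The segments of all cycles together form a single new cycle, which is closed by \<open>x\<close>. In exchange,
  the part that contains \<open>x\<close> disappears, so the number of parts does not grow.
\<close>
lemma cyc_partition_of_local_completion:
  assumes diamond: "adj x b" "adj x c" "adj x d" "adj b c" "adj b d" "c \<noteq> d" "\<not> adj c d"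
    and P': "cyc_partition V (local_completion adj x) P'"
  shows "\<exists>P. cyc_partition V adj P \<and> card P \<le> card P'"
proof -
  define K where "K = insert x (nb x)"
  interpret L: ugraph V "local_completion adj x" by (rule ugraph_local_completion)
  have part': "partition_on V P'" and cyc': "\<And>W. W \<in> P' \<Longrightarrow> cyclable (local_completion adj x) W"
    using P' by (auto simp: cyc_partition_def)
  have fP': "finite P'" using L.finite_cyc_partition[OF P'] .
  have WV: "W \<subseteq> V" if "W \<in> P'" for W using part' that by (auto simp: partition_on_def)
  have KV: "K \<subseteq> V" using adj_in diamond(1) by (auto simp: K_def)
  define cut where "cut W W0 \<S> \<longleftrightarrow> W0 \<subseteq> W \<and> W0 \<inter> K = {} \<and> (W0 = {} \<or> cyclable adj W0) \<and>
      (x \<in> W \<longrightarrow> W0 = {}) \<and> partition_on (W - W0) \<S> \<and> (\<forall>R\<in>\<S>. \<exists>q. segment adj K q \<and> set q = R)"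
    for W W0 \<S>
  have "\<exists>W0 \<S>. cut W W0 \<S>" if "W \<in> P'" for W
    unfolding cut_def
    by (rule cycle_into_segments[OF K_def cyc'[OF that] finite_subset[OF WV[OF that] finV]])
  then obtain W0 S where cut: "\<And>W. W \<in> P' \<Longrightarrow> cut W (W0 W) (S W)" by metis
  have W0: "\<And>W. W \<in> P' \<Longrightarrow> W0 W \<subseteq> W" "\<And>W. W \<in> P' \<Longrightarrow> W0 W \<inter> K = {}"
      "\<And>W. W \<in> P' \<Longrightarrow> W0 W = {} \<or> cyclable adj (W0 W)" "\<And>W. W \<in> P' \<Longrightarrow> x \<in> W \<Longrightarrow> W0 W = {}"
    and S: "\<And>W. W \<in> P' \<Longrightarrow> partition_on (W - W0 W) (S W)"
      "\<And>W R. W \<in> P' \<Longrightarrow> R \<in> S W \<Longrightarrow> \<exists>q. segment adj K q \<and> set q = R"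
    using cut unfolding cut_def by blast+
  define SS where "SS = (\<Union>W\<in>P'. S W)"
  define T where "T = (\<Union>W\<in>P'. W - W0 W)"
  have USW: "\<Union>(S W) = W - W0 W" if "W \<in> P'" for W
    using S(1)[OF that] by (simp add: partition_on_def)
  have USS: "\<Union>SS = T" using USW unfolding SS_def T_def by blast
  have TV: "T \<subseteq> V" using WV by (auto simp: T_def)
  have KT: "K \<subseteq> T"
  proof
    fix v assume v: "v \<in> K"
    then obtain W where "W \<in> P'" "v \<in> W" using KV part' unfolding partition_on_def by blast
    then show "v \<in> T" using W0(2) v unfolding T_def by blast
  qed
  have disj: "disjoint SS"
    unfolding disjoint_def
  proof (intro ballI impI)
    fix R R' assume R: "R \<in> SS" "R' \<in> SS" "R \<noteq> R'"
    then obtain W W' where W: "W \<in> P'" "W' \<in> P'" "R \<in> S W" "R' \<in> S W'" by (auto simp: SS_def)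
    show "R \<inter> R' = {}"
    proof (cases "W = W'")
      case True
      then show ?thesis using partition_onD2[OF S(1)[OF W(1)]] W R unfolding disjoint_def by blast
    next
      case False
      then have "W \<inter> W' = {}" using partition_on_parts_eq[OF part'] W by blast
      then show ?thesis using USW[OF W(1)] USW[OF W(2)] W by blast
    qed
  qed
  have finSS: "finite SS"
    using USS TV finV finite_subset finite_UnionD by metis
  have seg: "\<exists>q. segment adj K q \<and> set q = R" if "R \<in> SS" for R using that S(2) by (auto simp: SS_def)
  \<comment> \<open>all neighbours of \<open>x\<close> lie in \<open>K\<close>, so \<open>x\<close> is not on a longer segment\<close>
  have xseg: "R = {x}" if R: "R \<in> SS" "x \<in> R" for R
  proof -
    obtain q where q: "segment adj K q" "set q = R" using seg[OF R(1)] by auto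
    then obtain a where a: "a \<in> K" "successively adj q" "distinct q"
        "q = [a] \<or> (\<exists>b\<in>K. \<exists>r. q = a # r @ [b] \<and> r \<noteq> [] \<and> set r \<inter> K = {})"
      by (auto simp: segment_def)
    from a(4) show ?thesis
    proof (elim disjE bexE exE conjE)
      fix b r assume r: "b \<in> K" "q = a # r @ [b]" "r \<noteq> []" "set r \<inter> K = {}"
      then have "hd r \<notin> K" "last r \<notin> K" by (auto simp: disjoint_iff)
      moreover have "adj a (hd r)" "adj (last r) b"
        using a(2) r by (auto simp: successively_Cons successively_append_iff)
      moreover have "x = a \<or> x = b" using R(2) q(2) r by (auto simp: K_def)
      ultimately show ?thesis using adj_sym by (auto simp: K_def)
    qed (use q R in auto)
  qed
  have xin: "{x} \<in> SS" using KT xseg USS by (auto simp: K_def)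
  define S' where "S' = SS - {{x}}"
  have noX: "x \<notin> R" if "R \<in> S'" for R using that xseg by (auto simp: S'_def)
  have US': "\<Union>S' = T - {x}"
    using USS noX xin by (auto simp: S'_def)
  have nbS': "nb x \<subseteq> \<Union>S'" using KT US' adj_irrefl by (auto simp: K_def)
  have "\<exists>p. p \<noteq> [] \<and> distinct p \<and> successively adj p \<and> set p = \<Union>S' \<and> hd p \<in> nb x \<and> last p \<in> nb x"
  proof (rule join_segments[OF diamond])
    show "finite S'" "disjoint S'" using finSS disj by (auto simp: S'_def disjoint_def)
    show "S' \<noteq> {}" using nbS' diamond(1) by auto
    show "nb x \<subseteq> \<Union>S'" by (rule nbS')
    show "\<exists>p. segment adj (nb x) p \<and> set p = R" if R: "R \<in> S'" for R
    proof -
      obtain q where q: "segment adj K q" "set q = R" using R seg by (auto simp: S'_def)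
      have "x \<notin> set q" using noX[OF R] q(2) by simp
      then have "segment adj (nb x) q" using q(1) unfolding segment_def K_def
        by (elim conjE bexE disjE exE) auto
      then show ?thesis using q(2) by blast
    qed
  qed
  then obtain p where p: "p \<noteq> []" "distinct p" "successively adj p" "set p = \<Union>S'"
      "hd p \<in> nb x" "last p \<in> nb x" by blast
  have "cyc_list adj (x # p)"
    using p US' adj_sym by (auto simp: cyc_list_def successively_Cons)
  moreover have "set (x # p) = T" using p(4) US' KT by (auto simp: K_def)
  ultimately have cT: "cyclable adj T" unfolding cyclable_def by blast
  define P where "P = {T} \<union> (W0 ` P' - {{}})"
  have "partition_on (T \<union> \<Union>(W0 ` P')) P"
    unfolding P_def
  proof (rule partition_on_disjoint_Un)
    show "partition_on T {T}" using KT by (intro partition_on_space) (auto simp: K_def)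
    show "partition_on (\<Union>(W0 ` P')) (W0 ` P' - {{}})"
    proof (rule partition_onI)
      fix A B assume AB: "A \<in> W0 ` P' - {{}}" "B \<in> W0 ` P' - {{}}" "A \<noteq> B"
      then obtain W W' where W: "W \<in> P'" "W' \<in> P'" "A = W0 W" "B = W0 W'" by blast
      then have "W \<noteq> W'" using AB by auto
      then have "W \<inter> W' = {}" using partition_on_parts_eq[OF part'] W by blast
      then show "disjnt A B" using W0(1)[OF W(1)] W0(1)[OF W(2)] W by (auto simp: disjnt_def)
    qed auto
    show "T \<inter> \<Union>(W0 ` P') = {}"
    proof (rule ccontr)
      assume "T \<inter> \<Union>(W0 ` P') \<noteq> {}"
      then obtain v W W' where v: "W \<in> P'" "v \<in> W" "v \<notin> W0 W" "W' \<in> P'" "v \<in> W0 W'"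
        by (auto simp: T_def)
      then have "W = W'" using partition_on_parts_eq[OF part'] W0(1)[OF v(4)] by blast
      then show False using v by simp
    qed
  qed
  moreover have "T \<union> \<Union>(W0 ` P') = V"
  proof
    show "T \<union> \<Union>(W0 ` P') \<subseteq> V" using TV W0(1) WV by blast
    show "V \<subseteq> T \<union> \<Union>(W0 ` P')" using part' unfolding partition_on_def T_def by blast
  qed
  ultimately have "partition_on V P" by simp
  moreover have "\<forall>W\<in>P. cyclable adj W" using cT W0(3) by (auto simp: P_def)
  ultimately have "cyc_partition V adj P" by (simp add: cyc_partition_def)
  moreover have "card P \<le> card P'"
  proof -
    have "x \<in> \<Union>P'" using KV part' by (auto simp: K_def partition_on_def)
    then obtain Wx where Wx: "Wx \<in> P'" "x \<in> Wx" by blast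
    have "P \<subseteq> insert T (W0 ` (P' - {Wx}))" using W0(4)[OF Wx] by (auto simp: P_def)
    then have "card P \<le> card (insert T (W0 ` (P' - {Wx})))" using fP' by (intro card_mono) auto
    moreover have "card (insert T (W0 ` (P' - {Wx}))) \<le> Suc (card (W0 ` (P' - {Wx})))" using fP' by (simp add: card_insert_if)
    moreover have "card (W0 ` (P' - {Wx})) \<le> card (P' - {Wx})" using fP' by (intro card_image_le) auto
    moreover have "Suc (card (P' - {Wx})) = card P'" by (rule card_Suc_Diff1[OF fP' Wx(1)])
    ultimately show ?thesis by linarith
  qed
  ultimately show ?thesis by blast
qed

end

section \<open>Hall's marriage theorem\<close>

text \<open>
  The induction of Halmos and Vaughan: a proper non-empty subset for which Hall's condition is tight is
  matched separately; if there is none, a single element can be matched arbitrarily.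
\<close>
lemma halls_marriage:
  fixes N :: "'x \<Rightarrow> 'y set"
  assumes "finite X" and "\<And>x. x \<in> X \<Longrightarrow> finite (N x)"
    and "\<And>J. J \<subseteq> X \<Longrightarrow> card J \<le> card (\<Union>(N ` J))"
  shows "\<exists>f. inj_on f X \<and> (\<forall>x\<in>X. f x \<in> N x)"
  using assms
proof (induction "card X" arbitrary: X N rule: less_induct)
  case less
  note fX = less.prems(1) and fN = less.prems(2) and hall = less.prems(3)
  have glue: "\<exists>f. inj_on f X \<and> (\<forall>x\<in>X. f x \<in> N x)"
    if J: "J \<subseteq> X" and f: "inj_on f J" "\<forall>x\<in>J. f x \<in> N x"
      and g: "inj_on g (X - J)" "\<forall>x\<in>X-J. g x \<in> N x - Y" and Y: "f ` J \<subseteq> Y" for J f g Y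
  proof -
    let ?h = "\<lambda>x. if x \<in> J then f x else g x"
    have "g ` (X - J) \<inter> Y = {}" using g(2) by auto
    then have "f ` J \<inter> g ` (X - J) = {}" using Y by auto
    from inj_on_disjoint_Un[OF f(1) g(1) this] have "inj_on ?h (J \<union> (X - J))" .
    moreover have "J \<union> (X - J) = X" using J by auto
    ultimately have "inj_on ?h X" by simp
    moreover have "\<forall>x\<in>X. ?h x \<in> N x" using f(2) g(2) by auto
    ultimately show ?thesis by (intro exI[of _ ?h] conjI)
  qed
  show ?case
  proof (cases "X = {}")
    case False
    then obtain x where x: "x \<in> X" by auto
    show ?thesis
    proof (cases "\<exists>J. J \<subset> X \<and> J \<noteq> {} \<and> card (\<Union>(N ` J)) \<le> card J")
      case True
      then obtain J where J: "J \<subset> X" "J \<noteq> {}" "card (\<Union>(N ` J)) \<le> card J" by blast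
      let ?Y = "\<Union>(N ` J)"
      have fJ: "finite J" using J fX finite_subset by blast
      have fY: "finite ?Y" using fJ fN J by auto
      have "\<exists>f. inj_on f J \<and> (\<forall>x\<in>J. f x \<in> N x)"
      proof (rule less.hyps)
        show "card J < card X" using J fX by (intro psubset_card_mono) auto
        show "finite J" by (rule fJ)
        show "finite (N x)" if "x \<in> J" for x using that J fN by auto
        show "card A \<le> card (\<Union>(N ` A))" if "A \<subseteq> J" for A using that J by (intro hall) auto
      qed
      then obtain f where f: "inj_on f J" "\<forall>x\<in>J. f x \<in> N x" by blast
      have "\<exists>g. inj_on g (X - J) \<and> (\<forall>x\<in>X-J. g x \<in> N x - ?Y)"
      proof (rule less.hyps)
        show "card (X - J) < card X" using J fX by (intro psubset_card_mono) auto
        show "finite (X - J)" using fX by simp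
        show "finite (N x - ?Y)" if "x \<in> X - J" for x using that fN by auto
        fix A assume A: "A \<subseteq> X - J"
        have fA: "finite A" using A fX finite_subset by blast
        have "card J + card A = card (J \<union> A)"
          using A fJ fA by (subst card_Un_disjoint) auto
        also have "\<dots> \<le> card (\<Union>(N ` (J \<union> A)))" using A J by (intro hall) auto
        also have "\<Union>(N ` (J \<union> A)) = ?Y \<union> \<Union>((\<lambda>x. N x - ?Y) ` A)" by auto
        also have "card \<dots> \<le> card ?Y + card (\<Union>((\<lambda>x. N x - ?Y) ` A))" by (rule card_Un_le)
        finally show "card A \<le> card (\<Union>((\<lambda>x. N x - ?Y) ` A))" using J(3) by simp
      qed
      then obtain g where "inj_on g (X - J)" "\<forall>x\<in>X-J. g x \<in> N x - ?Y" by blast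
      then show ?thesis using J f by (intro glue[of J f g ?Y]) auto
    next
      case no: False
      have "card {x} \<le> card (\<Union>(N ` {x}))" using x by (intro hall) auto
      then have "N x \<noteq> {}" by auto
      then obtain y where y: "y \<in> N x" by auto
      have "\<exists>g. inj_on g (X - {x}) \<and> (\<forall>z\<in>X-{x}. g z \<in> N z - {y})"
      proof (rule less.hyps)
        show "card (X - {x}) < card X" using x fX by (intro psubset_card_mono) auto
        show "finite (X - {x})" using fX by simp
        show "finite (N z - {y})" if "z \<in> X - {x}" for z using that fN by auto
        fix A assume A: "A \<subseteq> X - {x}"
        show "card A \<le> card (\<Union>((\<lambda>z. N z - {y}) ` A))"
        proof (cases "A = {}")
          case False
          have AX: "A \<subset> X" using A x by auto
          then have "card A < card (\<Union>(N ` A))" using no False by (meson not_le_imp_less)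
          moreover have "\<Union>((\<lambda>z. N z - {y}) ` A) = \<Union>(N ` A) - {y}" by auto
          ultimately show ?thesis by (auto simp: card_Diff_singleton_if)
        qed simp
      qed
      then obtain g where "inj_on g (X - {x})" "\<forall>z\<in>X-{x}. g z \<in> N z - {y}" by blast
      then show ?thesis using x y by (intro glue[of "{x}" "\<lambda>_. y" g "{y}"]) auto
    qed
  qed simp
qed

section \<open>Even edge sets and closed trails\<close>

text \<open>
  A simple graph, given by its set of edges and their pairs of ends. Its line graph is the graph
  on \<open>E\<close> in which edges with a common end are adjacent.
\<close>
locale edge_ends =
  fixes E :: "'a set" and ends :: "'a \<Rightarrow> 'l set"
  assumes finE: "finite E"
    and card_ends: "e \<in> E \<Longrightarrow> card (ends e) = 2"
    and inj_ends: "inj_on ends E"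
begin

definition share :: "'a \<Rightarrow> 'a \<Rightarrow> bool" where
  "share e f \<longleftrightarrow> e \<in> E \<and> f \<in> E \<and> e \<noteq> f \<and> ends e \<inter> ends f \<noteq> {}"

definition deg :: "'a set \<Rightarrow> 'l \<Rightarrow> nat" where
  "deg F l = card {e \<in> F. l \<in> ends e}"

definition even_set :: "'a set \<Rightarrow> bool" where
  "even_set F \<longleftrightarrow> F \<subseteq> E \<and> (\<forall>l. even (deg F l))"

definition conn :: "'a set \<Rightarrow> ('l \<times> 'l) set" where
  "conn F = {(l, l'). \<exists>e\<in>F. l \<in> ends e \<and> l' \<in> ends e}\<^sup>*"

lemma finite_sub: "F \<subseteq> E \<Longrightarrow> finite F"
  using finE finite_subset by blast

lemma finite_ends: "e \<in> E \<Longrightarrow> finite (ends e)"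
  using card_ends[of e] card.infinite by fastforce

lemma other_end:
  assumes "e \<in> E" "l \<in> ends e"
  obtains m where "ends e = {l, m}" "l \<noteq> m"
proof -
  obtain a b where ab: "ends e = {a, b}" "a \<noteq> b" using card_ends[OF assms(1)] by (auto simp: card_2_iff)
  show thesis
  proof (cases "l = a")
    case False
    then have "l = b" using ab assms(2) by auto
    then show thesis using that[of a] ab by (simp add: insert_commute)
  qed (use that ab in auto)
qed

lemma ends_eq:
  assumes "e \<in> E" "f \<in> E" "ends e \<subseteq> {a, b}" "ends f \<subseteq> {a, b}"
  shows "e = f"
proof -
  have "ends g = {a, b}" if "g \<in> E" "ends g \<subseteq> {a, b}" for g
    by (rule card_seteq) (use that card_ends[OF that(1)] card_insert_le_m1[of 2 "{b}" a] in auto)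
  then show ?thesis using assms inj_ends by (metis inj_onD)
qed

lemma conn_refl [simp]: "(l, l) \<in> conn F" by (simp add: conn_def)

lemma conn_trans: "(a, b) \<in> conn F \<Longrightarrow> (b, c) \<in> conn F \<Longrightarrow> (a, c) \<in> conn F"
  unfolding conn_def by (rule rtrancl_trans)

lemma conn_sym: "(a, b) \<in> conn F \<Longrightarrow> (b, a) \<in> conn F"
proof -
  have "sym {(l, l'). \<exists>e\<in>F. l \<in> ends e \<and> l' \<in> ends e}" by (auto simp: sym_def)
  then show "(a, b) \<in> conn F \<Longrightarrow> (b, a) \<in> conn F"
    unfolding conn_def by (meson symD sym_rtrancl)
qed

lemma conn_edge: "e \<in> F \<Longrightarrow> a \<in> ends e \<Longrightarrow> b \<in> ends e \<Longrightarrow> (a, b) \<in> conn F"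
  unfolding conn_def by blast

lemma conn_mono:
  assumes "\<And>e a b. e \<in> F \<Longrightarrow> a \<in> ends e \<Longrightarrow> b \<in> ends e \<Longrightarrow> (a, b) \<in> conn F'"
  shows "conn F \<subseteq> conn F'"
proof -
  have "{(l, l'). \<exists>e\<in>F. l \<in> ends e \<and> l' \<in> ends e} \<subseteq> conn F'" using assms by blast
  then have "conn F \<subseteq> (conn F')\<^sup>*" unfolding conn_def[of F] by (rule rtrancl_mono)
  then show ?thesis by (simp add: conn_def)
qed

lemma even_deg_sym_diff:
  assumes "S \<subseteq> E" "S' \<subseteq> E"
  shows "even (deg (sym_diff S S') l) \<longleftrightarrow> even (deg S l + deg S' l)"
proof -
  let ?A = "{e \<in> S. l \<in> ends e}" and ?B = "{e \<in> S'. l \<in> ends e}"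
  have fin: "finite ?A" "finite ?B" using assms finite_sub by auto
  have "{e \<in> sym_diff S S'. l \<in> ends e} = (?A - ?B) \<union> (?B - ?A)" by auto
  then have "deg (sym_diff S S') l = card (?A - ?B) + card (?B - ?A)"
    unfolding deg_def using fin by (simp add: card_Un_disjoint Diff_disjoint disjoint_iff)
  moreover have "card ?A = card (?A - ?B) + card (?A \<inter> ?B)" "card ?B = card (?B - ?A) + card (?A \<inter> ?B)"
    using fin card_Int_Diff[of ?A ?B] card_Int_Diff[of ?B ?A] by (simp_all add: Int_commute)
  ultimately show ?thesis unfolding deg_def by presburger
qed

lemma even_set_sym_diff: "even_set F \<Longrightarrow> even_set Z \<Longrightarrow> even_set (sym_diff F Z)"
  using even_deg_sym_diff[of F Z] unfolding even_set_def by auto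

lemma handshake: "F \<subseteq> E \<Longrightarrow> ends ` F \<subseteq> Pow L \<Longrightarrow> finite L \<Longrightarrow> (\<Sum>l\<in>L. deg F l) = 2 * card F"
proof -
  assume F: "F \<subseteq> E" "ends ` F \<subseteq> Pow L" "finite L"
  have "(\<Sum>l\<in>L. deg F l) = (\<Sum>l\<in>L. \<Sum>e\<in>F. of_bool (l \<in> ends e))"
    using finite_sub[OF F(1)] by (intro sum.cong) (auto simp: deg_def Int_def)
  also have "\<dots> = (\<Sum>e\<in>F. \<Sum>l\<in>L. of_bool (l \<in> ends e))" by (rule sum.swap)
  also have "\<dots> = (\<Sum>e\<in>F. 2)"
  proof (rule sum.cong)
    fix e assume e: "e \<in> F"
    have "(\<Sum>l\<in>L. of_bool (l \<in> ends e) :: nat) = card (L \<inter> ends e)"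
      using F(3) by simp
    also have "L \<inter> ends e = ends e" using e F(2) by auto
    finally show "(\<Sum>l\<in>L. of_bool (l \<in> ends e)) = (2::nat)" using card_ends F(1) e by auto
  qed simp
  finally show ?thesis by simp
qed

text \<open>
  With at least as many edges as vertices there are more edge sets than parity patterns on all
  vertices but one; two sets with the same pattern differ by an even set, since by the handshake
  lemma the parity at the last vertex is determined as well.
\<close>
lemma ex_even_set:
  assumes A: "A \<subseteq> E" and ends: "\<And>e. e \<in> A \<Longrightarrow> ends e \<subseteq> L" and L: "finite L" "L \<noteq> {}"
    and many: "card L \<le> card A"
  shows "\<exists>Z\<subseteq>A. Z \<noteq> {} \<and> even_set Z"
proof -
  obtain l0 where l0: "l0 \<in> L" using L by auto
  define par where "par S = {l \<in> L - {l0}. odd (deg S l)}" for S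
  have fA: "finite A" using A finite_sub by simp
  have "card (par ` Pow A) \<le> card (Pow (L - {l0}))"
    by (rule card_mono) (use L in \<open>auto simp: par_def\<close>)
  also have "\<dots> = 2 ^ (card L - 1)" using L l0 by (simp add: card_Pow card_Diff_singleton)
  also have "\<dots> < 2 ^ card A"
  proof (rule power_strict_increasing)
    have "card L > 0" using L by (simp add: card_gt_0_iff)
    then show "card L - 1 < card A" using many by linarith
  qed simp
  also have "\<dots> = card (Pow A)" using fA by (simp add: card_Pow)
  finally have "\<not> inj_on par (Pow A)" using pigeonhole by blast
  then obtain S S' where S: "S \<subseteq> A" "S' \<subseteq> A" "S \<noteq> S'" "par S = par S'"
    by (auto simp: inj_on_def)
  define Z where "Z = sym_diff S S'"
  have ZA: "Z \<subseteq> A" and Zne: "Z \<noteq> {}" using S by (auto simp: Z_def)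
  have out: "deg Z l = 0" if "l \<notin> L" for l
  proof -
    have "{e \<in> Z. l \<in> ends e} = {}" using ZA ends that by auto
    then show ?thesis by (simp only: deg_def card.empty)
  qed
  have inL: "even (deg Z l)" if "l \<in> L - {l0}" for l
  proof -
    have "odd (deg S l) \<longleftrightarrow> odd (deg S' l)" using S(4) that unfolding par_def by blast
    then show ?thesis using even_deg_sym_diff[of S S' l] S A by (auto simp: Z_def)
  qed
  have "(\<Sum>l\<in>L. deg Z l) = 2 * card Z" using ZA A ends L by (intro handshake) auto
  then have "deg Z l0 + (\<Sum>l\<in>L - {l0}. deg Z l) = 2 * card Z"
    using sum.remove[OF L(1) l0, of "deg Z"] by simp
  moreover have "even (\<Sum>l\<in>L - {l0}. deg Z l)" using inL by (intro dvd_sum) auto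
  ultimately have "even (deg Z l0)" by (metis dvd_triv_left even_add)
  then have "even_set Z" using inL out ZA A unfolding even_set_def
    by (metis Diff_iff dvd_0_right order_trans singletonD)
  then show ?thesis using ZA Zne by blast
qed

text \<open>
  Trails and walks are lists of pairs of a vertex and the edge by which it is left; the next vertex
  of a walk may be the same one again. Recording the vertices fixes which ones are visited, so that
  edges can be inserted at them.
\<close>

fun trail :: "'l \<Rightarrow> ('l \<times> 'a) list \<Rightarrow> 'l \<Rightarrow> bool" where
  "trail l [] l' \<longleftrightarrow> l = l'"
| "trail l ((m, e) # ps) l' \<longleftrightarrow> m = l \<and> (\<exists>m'. ends e = {l, m'} \<and> trail m' ps l')"

fun walk :: "'l \<Rightarrow> ('l \<times> 'a) list \<Rightarrow> 'l \<Rightarrow> bool" where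
  "walk l [] l' \<longleftrightarrow> l = l'"
| "walk l ((m, e) # ps) l' \<longleftrightarrow> m = l \<and> l \<in> ends e \<and> (\<exists>m'\<in>ends e. walk m' ps l')"

abbreviation used :: "('l \<times> 'a) list \<Rightarrow> 'a set" where "used ps \<equiv> snd ` set ps"

lemma trail_append: "trail l (ps @ qs) l' \<longleftrightarrow> (\<exists>m. trail l ps m \<and> trail m qs l')"
  by (induction l ps l' rule: trail.induct) auto

lemma walk_append: "walk l (ps @ qs) l' \<longleftrightarrow> (\<exists>m. walk l ps m \<and> walk m qs l')"
  by (induction l ps l' rule: walk.induct) auto

lemma trail_walk: "trail l ps l' \<Longrightarrow> walk l ps l'"
  by (induction l ps l' rule: trail.induct) auto

lemma trail_conn: "trail l ps l' \<Longrightarrow> used ps \<subseteq> F \<Longrightarrow> (l, l') \<in> conn F"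
proof (induction l ps l' rule: trail.induct)
  case (2 l m e ps l')
  then obtain m' where m': "ends e = {l, m'}" "trail m' ps l'" by auto
  then have "(m', l') \<in> conn F" using 2 by auto
  moreover have "(l, m') \<in> conn F" using conn_edge[of e F l m'] m' 2 by auto
  ultimately show ?case by (rule conn_trans[rotated])
qed simp

lemma deg_insert:
  assumes "finite S" "e \<notin> S"
  shows "deg (insert e S) v = deg S v + of_bool (v \<in> ends e)"
proof -
  have "{f \<in> insert e S. v \<in> ends f} = (if v \<in> ends e then insert e {f \<in> S. v \<in> ends f} else {f \<in> S. v \<in> ends f})"
    by auto
  then show ?thesis using assms by (simp add: deg_def)
qed

lemma trail_parity:
  "trail l ps l' \<Longrightarrow> distinct (map snd ps) \<Longrightarrow> used ps \<subseteq> E \<Longrightarrow>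
    odd (deg (used ps) v) \<longleftrightarrow> (v = l) \<noteq> (v = l')"
proof (induction l ps l' rule: trail.induct)
  case (2 l m e ps l')
  then obtain m' where m': "ends e = {l, m'}" "trail m' ps l'" by auto
  have "l \<noteq> m'" using card_ends[of e] 2 m' by auto
  moreover have "odd (deg (used ps) v) \<longleftrightarrow> (v = m') \<noteq> (v = l')" using 2 m' by auto
  moreover have "deg (used ((m, e) # ps)) v = deg (used ps) v + of_bool (v \<in> ends e)"
    using 2 by (simp add: deg_insert)
  ultimately show ?case using m' by auto
qed (simp add: deg_def)

lemma finite_distinct_trails:
  assumes "F \<subseteq> E"
  shows "distinct (map snd ps) \<Longrightarrow> used ps \<subseteq> F \<Longrightarrow> length ps < Suc (card F)"
  using card_mono[OF finite_sub[OF assms], of "set (map snd ps)"] distinct_card[of "map snd ps"] by simp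

text \<open>
  A longest trail starting with \<open>e\<close> is closed: at any other final vertex it would use an odd number of
  edges, so that one of the edges there would be left to continue.
\<close>
lemma ex_closed_trail:
  assumes F: "even_set F" and e: "e \<in> F" "l \<in> ends e"
  shows "\<exists>ps. trail l ((l, e) # ps) l \<and> distinct (map snd ((l, e) # ps)) \<and> used ((l, e) # ps) \<subseteq> F"
proof -
  have FE: "F \<subseteq> E" using F by (simp add: even_set_def)
  define good where "good ps \<longleftrightarrow> (\<exists>l'. trail l ((l, e) # ps) l') \<and> distinct (map snd ((l, e) # ps))
    \<and> used ((l, e) # ps) \<subseteq> F" for ps
  obtain m where m: "ends e = {l, m}" using other_end e FE by blast
  have "good []" using e m by (auto simp: good_def)
  moreover have "length ps < Suc (card F)" if "good ps" for ps
    using finite_distinct_trails[OF FE, of "(l, e) # ps"] that by (auto simp: good_def)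
  ultimately obtain ps where ps: "good ps" and max: "\<And>qs. good qs \<Longrightarrow> length qs \<le> length ps"
    using ex_has_greatest_nat[of good "[]" length "Suc (card F)"] by blast
  obtain l' where t: "trail l ((l, e) # ps) l'" using ps by (auto simp: good_def)
  define U where "U = used ((l, e) # ps)"
  have d: "distinct (map snd ((l, e) # ps))" and UF: "U \<subseteq> F" using ps by (auto simp: good_def U_def)
  have "l' = l"
  proof (rule ccontr)
    assume ne: "l' \<noteq> l"
    have "odd (deg U l')" using trail_parity[OF t d, of l'] UF FE ne unfolding U_def by blast
    moreover have "even (deg F l')" using F by (simp add: even_set_def)
    ultimately have "deg U l' \<noteq> deg F l'" by metis
    then have "\<exists>f\<in>F. f \<notin> U \<and> l' \<in> ends f"
      using UF unfolding deg_def by (metis (mono_tags, lifting) Collect_cong subsetD)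
    then obtain f where f: "f \<in> F" "f \<notin> U" "l' \<in> ends f" by blast
    obtain m where m: "ends f = {l', m}" using other_end f FE by blast
    have "trail l (((l, e) # ps) @ [(l', f)]) m"
      unfolding trail_append using t m by auto
    then have "good (ps @ [(l', f)])" unfolding good_def using d UF f by (auto simp: U_def)
    then show False using max[of "ps @ [(l', f)]"] by simp
  qed
  then show ?thesis using t d UF unfolding U_def by blast
qed

text \<open>
  A closed trail that starts with \<open>e\<close> leads back from one end of \<open>e\<close> to the other without using \<open>e\<close>
  again.
\<close>
lemma even_set_no_bridge:
  assumes F: "even_set F" and e: "e \<in> F" "ends e = {a, b}"
  shows "(a, b) \<in> conn (F - {e})"
proof -
  obtain ps where ps: "trail a ((a, e) # ps) a" "distinct (map snd ((a, e) # ps))" "used ((a, e) # ps) \<subseteq> F"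
    using ex_closed_trail[OF F e(1), of a] e(2) by auto
  then obtain m where m: "ends e = {a, m}" "trail m ps a" by auto
  then have "m = b" using e(2) by (metis doubleton_eq_iff)
  moreover have "used ps \<subseteq> F - {e}" using ps by auto
  ultimately show ?thesis using trail_conn[OF m(2)] conn_sym by blast
qed

end

context edge_ends begin

lemma conn_touch:
  assumes "e \<in> F" "a \<in> ends e" "b \<in> ends e" "(x, a) \<in> conn F"
  shows "(x, b) \<in> conn F"
  using conn_trans[OF assms(4)] conn_edge[OF assms(1-3)] by blast

text \<open>
  Euler's theorem. The edges that a longest closed trail at \<open>x\<close> does not use form an even set again. If
  one of them had an end on the trail, a closed trail through it could be spliced in.
\<close>
lemma closed_trail_covering_component:
  assumes F: "even_set F"
  shows "\<exists>ps. trail x ps x \<and> distinct (map snd ps)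
    \<and> used ps = {e \<in> F. ends e \<inter> conn F `` {x} \<noteq> {}} \<and> conn F `` {x} \<subseteq> insert x (fst ` set ps)"
proof -
  have FE: "F \<subseteq> E" using F by (simp add: even_set_def)
  define good where "good ps \<longleftrightarrow> trail x ps x \<and> distinct (map snd ps) \<and> used ps \<subseteq> F" for ps
  have "good []" by (auto simp: good_def)
  moreover have "length ps < Suc (card F)" if "good ps" for ps
    using finite_distinct_trails[OF FE, of ps] that by (auto simp: good_def)
  ultimately obtain ps where ps: "good ps" and max: "\<And>qs. good qs \<Longrightarrow> length qs \<le> length ps"
    using ex_has_greatest_nat[of good "[]" length "Suc (card F)"] by blast
  have t: "trail x ps x" and d: "distinct (map snd ps)" and UF: "used ps \<subseteq> F"
    using ps by (auto simp: good_def)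
  define U where "U = used ps"
  have evU: "even (deg U v)" for v
    using trail_parity[OF t d, of v] UF FE unfolding U_def by blast
  define R where "R = F - U"
  have evR: "even_set R"
  proof -
    have "R = sym_diff F U" using UF by (auto simp: R_def U_def)
    moreover have "even_set U" using evU UF FE by (auto simp: even_set_def U_def)
    ultimately show ?thesis using even_set_sym_diff[OF F] by simp
  qed
  define vis where "vis = insert x (fst ` set ps)"
  have cut: "\<exists>ys zs. ps = ys @ zs \<and> trail x ys l \<and> trail l zs x" if "l \<in> vis" for l
  proof (cases "l = x")
    case True
    then show ?thesis using t by (intro exI[of _ "[]"] exI[of _ ps]) auto
  next
    case False
    then obtain e where "(l, e) \<in> set ps" using \<open>l \<in> vis\<close> by (auto simp: vis_def)
    then obtain ys zs where sp: "ps = ys @ (l, e) # zs" by (meson split_list)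
    then obtain m where "trail x ys m" "trail m ((l, e) # zs) x" using t trail_append by blast
    then show ?thesis using sp by (intro exI[of _ ys] exI[of _ "(l, e) # zs"]) auto
  qed
  have all_used: "e \<in> U" if e: "e \<in> F" "l \<in> ends e" and l: "l \<in> vis" for e l
  proof (rule ccontr)
    assume "e \<notin> U"
    then have "e \<in> R" using e by (simp add: R_def)
    from ex_closed_trail[OF evR this e(2)] obtain qs
      where qs: "trail l ((l, e) # qs) l" "distinct (map snd ((l, e) # qs))" "used ((l, e) # qs) \<subseteq> R"
      by blast
    obtain ys zs where sp: "ps = ys @ zs" "trail x ys l" "trail l zs x" using cut[OF l] by blast
    let ?q = "ys @ ((l, e) # qs) @ zs"
    have "trail x ?q x" unfolding trail_append using sp qs(1) by blast
    moreover have "distinct (map snd ?q)"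
    proof -
      have "set (map snd ((l, e) # qs)) \<inter> set (map snd ps) = {}"
        using qs(3) by (auto simp: R_def U_def)
      then show ?thesis using d qs(2) sp(1) by auto
    qed
    moreover have "used ?q \<subseteq> F" using UF qs(3) sp(1) by (auto simp: R_def)
    ultimately have "good ?q" by (simp add: good_def)
    then show False using max[of ?q] sp(1) by simp
  qed
  have ends_vis: "m \<in> vis" if e: "e \<in> U" "m \<in> ends e" for e m
  proof -
    obtain l where "(l, e) \<in> set ps" using e(1) unfolding U_def by force
    then obtain ys zs where sp: "ps = ys @ (l, e) # zs" by (meson split_list)
    then obtain m' where m': "ends e = {l, m'}" "trail m' zs x"
      using t trail_append[of x ys "(l, e) # zs" x] by auto
    have "m' \<in> vis"
    proof (cases zs)
      case (Cons z zs')
      then have "fst z = m'" using m'(2) by (cases z) auto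
      then show ?thesis using sp Cons by (auto simp: vis_def image_iff)
    qed (use m' in \<open>simp add: vis_def\<close>)
    then show ?thesis using m'(1) e(2) sp by (auto simp: vis_def image_iff)
  qed
  have Dvis: "l \<in> vis" if "(x, l) \<in> conn F" for l
    using that unfolding conn_def
  proof (induction rule: rtrancl_induct)
    case (step y z)
    then obtain e where "e \<in> F" "y \<in> ends e" "z \<in> ends e" by auto
    then show ?case using all_used[of e y] ends_vis[of e z] step by simp
  qed (simp add: vis_def)
  have "U = {e \<in> F. ends e \<inter> conn F `` {x} \<noteq> {}}"
  proof (intro equalityI subsetI CollectI conjI)
    fix e assume e: "e \<in> U"
    then show "e \<in> F" using UF by (auto simp: U_def)
    obtain l where "(l, e) \<in> set ps" using e unfolding U_def by force
    then obtain ys zs where sp: "ps = ys @ (l, e) # zs" by (meson split_list)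
    then obtain m where "trail x ys m" "trail m ((l, e) # zs) x" using t trail_append by blast
    then have "trail x ys l" "l \<in> ends e" by auto
    moreover have "used ys \<subseteq> F" using UF sp by auto
    ultimately show "ends e \<inter> conn F `` {x} \<noteq> {}" using trail_conn by blast
  next
    fix e assume "e \<in> {e \<in> F. ends e \<inter> conn F `` {x} \<noteq> {}}"
    then show "e \<in> U" using all_used Dvis by blast
  qed
  then show ?thesis using t d Dvis unfolding U_def vis_def by blast
qed

text \<open>
  Beyond the trail through the edges of \<open>F\<close>, each further edge has an end on the trail, and it is
  inserted there without moving to another vertex.
\<close>
lemma closed_walk_covering:
  assumes F: "even_set F" and W: "W \<subseteq> E"
    and FW: "{e \<in> F. ends e \<inter> conn F `` {x} \<noteq> {}} \<subseteq> W"
    and touch: "\<And>e. e \<in> W \<Longrightarrow> ends e \<inter> conn F `` {x} \<noteq> {}"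
  shows "\<exists>ps. walk x ps x \<and> distinct (map snd ps) \<and> used ps = W"
proof -
  let ?D = "conn F `` {x}"
  let ?F = "{e \<in> F. ends e \<inter> ?D \<noteq> {}}"
  have "\<exists>ps. walk x ps x \<and> distinct (map snd ps) \<and> used ps = ?F \<union> A \<and> ?D \<subseteq> insert x (fst ` set ps)"
    if "finite A" "A \<subseteq> W" "A \<inter> ?F = {}" for A
    using that
  proof (induction A rule: finite_induct)
    case empty
    then show ?case using closed_trail_covering_component[OF F, of x] trail_walk by auto
  next
    case (insert e A)
    then obtain ps where ps: "walk x ps x" "distinct (map snd ps)" "used ps = ?F \<union> A"
      "?D \<subseteq> insert x (fst ` set ps)" by auto
    obtain l where l: "l \<in> ends e" "l \<in> ?D" using touch[of e] insert.prems by blast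
    have new: "e \<notin> used ps" using ps(3) insert by auto
    consider "l = x" | f where "(l, f) \<in> set ps" using ps(4) l by auto
    then show ?case
    proof cases
      case 1
      then show ?thesis using ps l new by (intro exI[of _ "(x, e) # ps"]) auto
    next
      case 2
      then obtain ys zs where sp: "ps = ys @ (l, f) # zs" by (meson split_list)
      let ?q = "ys @ (l, e) # (l, f) # zs"
      have "walk x ?q x" using ps(1) l(1) unfolding sp walk_append by auto
      moreover have "distinct (map snd ?q)" using ps(2) new unfolding sp by auto
      moreover have "used ?q = ?F \<union> insert e A" using ps(3) unfolding sp by auto
      moreover have "insert x (fst ` set ps) \<subseteq> insert x (fst ` set ?q)" unfolding sp by auto
      ultimately show ?thesis using order_trans[OF ps(4)] by (intro exI[of _ ?q] conjI)
    qed
  qed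
  from this[of "W - ?F"] show ?thesis using finite_sub[OF W] FW by (auto simp: Un_absorb1)
qed

lemma walk_path:
  "walk l ps l' \<Longrightarrow> ps \<noteq> [] \<Longrightarrow> distinct (map snd ps) \<Longrightarrow> used ps \<subseteq> E \<Longrightarrow>
    successively share (map snd ps) \<and> l \<in> ends (hd (map snd ps)) \<and> l' \<in> ends (last (map snd ps))"
proof (induction l ps l' rule: walk.induct)
  case (2 l m e ps l')
  then obtain m' where m': "m' \<in> ends e" "walk m' ps l'" "l \<in> ends e" by auto
  show ?case
  proof (cases "ps = []")
    case False
    then have IH: "successively share (map snd ps)" "m' \<in> ends (hd (map snd ps))"
        "l' \<in> ends (last (map snd ps))" using 2 m' by auto
    have "hd (map snd ps) \<in> used ps" using False by (metis hd_in_set list.map_disc_iff set_map)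
    then have "share e (hd (map snd ps))" using 2 m' IH unfolding share_def by auto
    then show ?thesis using IH False m' by (simp add: successively_Cons)
  qed (use m' in simp)
qed simp

lemma cyclable_if_touches_component:
  assumes F: "even_set F" and W: "W \<subseteq> E" "W \<noteq> {}"
    and FW: "{e \<in> F. ends e \<inter> conn F `` {x} \<noteq> {}} \<subseteq> W"
    and touch: "\<And>e. e \<in> W \<Longrightarrow> ends e \<inter> conn F `` {x} \<noteq> {}"
  shows "cyclable share W"
proof -
  obtain ps where ps: "walk x ps x" "distinct (map snd ps)" "used ps = W"
    using closed_walk_covering[OF F W(1) FW touch] by blast
  let ?c = "map snd ps"
  have ne: "ps \<noteq> []" using ps(3) W(2) by auto
  have p: "successively share ?c" "x \<in> ends (hd ?c)" "x \<in> ends (last ?c)"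
    using walk_path[OF ps(1) ne ps(2)] ps(3) W(1) by auto
  have "length ?c = 1 \<or> share (last ?c) (hd ?c)"
  proof (cases "last ?c = hd ?c")
    case True
    have "length c = 1" if "distinct c" "c \<noteq> []" "last c = hd c" for c :: "'a list"
      using that by (cases c) (auto split: if_splits)
    from this[of ?c] True show ?thesis using ps(2) ne by simp
  next
    case False
    have "last ?c \<in> E" "hd ?c \<in> E" using ps(3) W(1) ne
      by (metis hd_in_set last_in_set list.map_disc_iff set_map subsetD)+
    then show ?thesis using False p by (auto simp: share_def)
  qed
  then have "cyc_list share ?c" using ps(2) ne p by (simp add: cyc_list_def)
  then show ?thesis using ps(3) unfolding cyclable_def by (intro exI[of _ ?c]) auto
qed

end

section \<open>Optimal dominating even edge sets\<close>

context edge_ends begin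

text \<open>
  The members of \<open>X\<close> represent components of \<open>F\<close>; isolated vertices count as components.
\<close>
definition dominating :: "'a set \<Rightarrow> 'l set \<Rightarrow> bool" where
  "dominating F X \<longleftrightarrow> even_set F \<and> finite X \<and> (\<forall>e\<in>E. ends e \<inter> conn F `` X \<noteq> {})"

text \<open>
  The number of represented components is minimal, and with this number they cover as many vertices as
  possible.
\<close>
definition optimal :: "'a set \<Rightarrow> 'l set \<Rightarrow> bool" where
  "optimal F X \<longleftrightarrow> dominating F X \<and>
    (\<forall>F' X'. dominating F' X' \<longrightarrow> card X \<le> card X' \<and>
      (card X' = card X \<longrightarrow> card (conn F' `` X') \<le> card (conn F `` X)))"

lemma conn_Image_subset:
  assumes "even_set F"
  shows "conn F `` X \<subseteq> X \<union> \<Union>(ends ` E)"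
proof -
  have FE: "F \<subseteq> E" using assms by (simp add: even_set_def)
  have "l = x \<or> l \<in> \<Union>(ends ` E)" if "(x, l) \<in> conn F" for x l
    using that unfolding conn_def by (cases rule: rtranclE) (use FE in auto)
  then show ?thesis by auto
qed

lemma finite_lines: "finite (\<Union>(ends ` E))"
  using finE finite_ends by auto

lemma finite_conn_Image: "even_set F \<Longrightarrow> finite X \<Longrightarrow> finite (conn F `` X)"
  using conn_Image_subset[of F X] finite_lines finite_subset by blast

lemma ex_optimal: "\<exists>F X. optimal F X"
proof -
  let ?d = "\<lambda>(F, X). dominating F X"
  have "dominating {} (\<Union>(ends ` E))"
  proof -
    have "ends e \<noteq> {}" if "e \<in> E" for e using card_ends[OF that] by auto
    then show ?thesis
      using finite_lines conn_refl unfolding dominating_def even_set_def deg_def by fastforce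
  qed
  then have ex: "\<exists>p. ?d p" by auto
  define m where "m = (LEAST m. \<exists>p. ?d p \<and> card (snd p) = m)"
  have "\<exists>p. ?d p \<and> card (snd p) = m" unfolding m_def by (rule LeastI_ex) (use ex in blast)
  then obtain p0 where p0: "?d p0 \<and> card (snd p0) = m" by blast
  have least: "m \<le> card (snd p)" if "?d p" for p
    unfolding m_def by (rule Least_le) (use that in blast)
  let ?f = "\<lambda>(F, X). card (conn F `` X)"
  have "\<exists>p. (?d p \<and> card (snd p) = m) \<and> (\<forall>q. ?d q \<and> card (snd q) = m \<longrightarrow> ?f q \<le> ?f p)"
  proof (rule ex_has_greatest_nat)
    show "?d p0 \<and> card (snd p0) = m" by (rule p0)
    show "\<forall>q. ?d q \<and> card (snd q) = m \<longrightarrow> ?f q < Suc (m + card (\<Union>(ends ` E)))"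
    proof (intro allI impI)
      fix q assume q: "?d q \<and> card (snd q) = m"
      obtain F X where FX: "q = (F, X)" by (cases q)
      have d: "even_set F" "finite X" "card X = m" using q by (auto simp: FX dominating_def)
      have "card (conn F `` X) \<le> card (X \<union> \<Union>(ends ` E))"
        using conn_Image_subset[OF d(1)] finite_lines d(2) by (intro card_mono) auto
      also have "\<dots> \<le> m + card (\<Union>(ends ` E))" using card_Un_le d(3) by metis
      finally show "?f q < Suc (m + card (\<Union>(ends ` E)))" by (simp add: FX)
    qed
  qed
  then obtain p where p: "?d p" "card (snd p) = m"
      "\<And>q. ?d q \<Longrightarrow> card (snd q) = m \<Longrightarrow> ?f q \<le> ?f p" by blast
  obtain F X where FX: "p = (F, X)" by (cases p)
  have "optimal F X"
    unfolding optimal_def using p least unfolding FX by auto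
  then show ?thesis by blast
qed

context
  fixes F X
  assumes opt: "optimal F X"
begin

lemma evF: "even_set F" and finX: "finite X"
  and dom: "e \<in> E \<Longrightarrow> ends e \<inter> conn F `` X \<noteq> {}"
  using opt by (auto simp: optimal_def dominating_def)

lemma FE: "F \<subseteq> E" using evF by (simp add: even_set_def)

text \<open>
  An even set that keeps the components of \<open>F\<close> connected would be better than \<open>F\<close> if it merged two
  components, as one representative less would suffice, or if it enlarged one.
\<close>
lemma optimal_no_improvement:
  assumes F': "even_set F'" and sub: "conn F \<subseteq> conn F'"
  shows "x \<in> X \<Longrightarrow> x' \<in> X \<Longrightarrow> (x, x') \<in> conn F' \<Longrightarrow> x = x'"
    and "conn F' `` X = conn F `` X"
proof -
  have dom': "ends e \<inter> conn F' `` X \<noteq> {}" if "e \<in> E" for e using dom[OF that] sub by blast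
  show "x = x'" if x: "x \<in> X" "x' \<in> X" "(x, x') \<in> conn F'"
  proof (rule ccontr)
    assume ne: "x \<noteq> x'"
    have "conn F' `` X \<subseteq> conn F' `` (X - {x'})"
    proof
      fix l assume "l \<in> conn F' `` X"
      then obtain z where z: "z \<in> X" "(z, l) \<in> conn F'" by auto
      show "l \<in> conn F' `` (X - {x'})"
      proof (cases "z = x'")
        case True
        then have "(x, l) \<in> conn F'" using conn_trans x(3) z(2) by blast
        then show ?thesis using x ne by auto
      qed (use z in auto)
    qed
    then have "dominating F' (X - {x'})"
      using F' finX dom' unfolding dominating_def by blast
    then have "card X \<le> card (X - {x'})" using opt by (auto simp: optimal_def)
    then show False using card_Diff1_less[OF finX x(2)] by simp
  qed
  have "dominating F' X" using F' finX dom' unfolding dominating_def by blast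
  then have "card (conn F' `` X) \<le> card (conn F `` X)" using opt by (auto simp: optimal_def)
  then show "conn F' `` X = conn F `` X"
    using card_seteq[OF finite_conn_Image[OF F' finX], of "conn F `` X"] Image_mono[OF sub, of X X]
    by simp
qed

lemma comp_unique:
  assumes "x \<in> X" "x' \<in> X" "(x, l) \<in> conn F" "(x', l) \<in> conn F"
  shows "x = x'"
  by (rule optimal_no_improvement(1)[OF evF subset_refl assms(1,2) conn_trans[OF assms(3) conn_sym[OF assms(4)]]])

text \<open>
  If \<open>L\<close> meets each component represented in \<open>X\<close> in at most one vertex, or in the two ends
  of an edge of \<open>F\<close>, then an even set \<open>Z\<close> between vertices of \<open>L\<close> could be added to \<open>F\<close> (modulo 2) without disconnecting
  any component, because at most one edge of each component is lost. This would merge two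
  components or enlarge one.
\<close>
lemma no_even_set_within:
  assumes L: "\<And>x. x \<in> X \<Longrightarrow> \<exists>a b. L \<inter> conn F `` {x} \<subseteq> {a, b} \<and> (a = b \<or> (\<exists>e\<in>F. ends e = {a, b}))"
    and Z: "even_set Z" "\<And>e. e \<in> Z \<Longrightarrow> ends e \<subseteq> L"
  shows "Z = {}"
proof (rule ccontr)
  assume "Z \<noteq> {}"
  have ZE: "Z \<subseteq> E" using Z(1) by (simp add: even_set_def)
  have in_comp: "f \<in> F \<and> (e \<in> E \<longrightarrow> e = f)"
    if "x \<in> X" "f \<in> E" "ends f \<subseteq> L \<inter> conn F `` {x}" "ends e \<subseteq> L \<inter> conn F `` {x}" for x e f
  proof -
    obtain a b where ab: "L \<inter> conn F `` {x} \<subseteq> {a, b}" "a = b \<or> (\<exists>e\<in>F. ends e = {a, b})"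
      using L \<open>x \<in> X\<close> by blast
    have "a \<noteq> b"
    proof
      assume "a = b"
      then have "ends f \<subseteq> {a}" using ab that by auto
      then show False using card_ends[OF \<open>f \<in> E\<close>] card_mono[of "{a}" "ends f"] by simp
    qed
    then obtain g where g: "g \<in> F" "ends g = {a, b}" using ab by blast
    have "f = g" using ends_eq[of f g a b] that g ab(1) FE by blast
    moreover have "e \<in> E \<longrightarrow> e = f" using ends_eq[of e f a b] that ab(1) by blast
    ultimately show ?thesis using g by blast
  qed
  have comp_of: "\<exists>x\<in>X. ends e \<subseteq> conn F `` {x}" if e: "e \<in> F" for e
  proof -
    obtain x l where "x \<in> X" "l \<in> ends e" "(x, l) \<in> conn F" using dom[of e] e FE by blast
    then show ?thesis using conn_touch[OF e] by blast
  qed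
  define F' where "F' = sym_diff F Z"
  have evF': "even_set F'" unfolding F'_def by (rule even_set_sym_diff[OF evF Z(1)])
  have sub: "conn F \<subseteq> conn F'"
  proof (rule conn_mono)
    fix e a b assume e: "e \<in> F" "a \<in> ends e" "b \<in> ends e"
    show "(a, b) \<in> conn F'"
    proof (cases "e \<in> Z \<and> a \<noteq> b")
      case False
      then show ?thesis using e conn_edge[of e F' a b] by (auto simp: F'_def)
    next
      case True
      obtain x where x: "x \<in> X" "ends e \<subseteq> conn F `` {x}" using comp_of[OF e(1)] by blast
      have "ends e = {a, b}"
        by (rule card_seteq[symmetric]) (use e True card_ends FE finite_ends in auto)
      then have "(a, b) \<in> conn (F - {e})" using even_set_no_bridge[OF evF e(1)] by blast
      then have "(a, b) \<in> conn F' \<and> (x, b) \<in> conn F"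
        unfolding conn_def[of "F - {e}"]
      proof (induction rule: rtrancl_induct)
        case base
        then show ?case using x e by auto
      next
        case (step y z)
        then obtain f where f: "f \<in> F" "f \<noteq> e" "y \<in> ends f" "z \<in> ends f" by auto
        have cf: "ends f \<subseteq> conn F `` {x}" using conn_touch[OF f(1,3)] step.IH by auto
        have "f \<notin> Z"
        proof
          assume "f \<in> Z"
          then have "e = f" using in_comp[OF x(1), of f e] Z(2) cf x(2) True FE e f by blast
          then show False using f by simp
        qed
        then have "(y, z) \<in> conn F'" using conn_edge[of f F' y z] f by (simp add: F'_def)
        then show ?case using step.IH conn_trans cf f(4) by blast
      qed
      then show ?thesis ..
    qed
  qed
  have "\<exists>e\<in>Z. e \<notin> F"
  proof (rule ccontr)
    assume "\<not> ?thesis"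
    then have ZF: "Z \<subseteq> F" by auto
    obtain e where e: "e \<in> Z" using \<open>Z \<noteq> {}\<close> by auto
    then obtain x where x: "x \<in> X" "ends e \<subseteq> conn F `` {x}" using comp_of ZF by blast
    obtain a where a: "a \<in> ends e" using card_ends[of e] e ZE by fastforce
    have "{f \<in> Z. a \<in> ends f} = {e}"
    proof (intro equalityI subsetI)
      fix f assume f: "f \<in> {f \<in> Z. a \<in> ends f}"
      have "ends f \<subseteq> conn F `` {x}" using conn_touch[of f F a] f ZF x a by blast
      then have "f = e" using in_comp[OF x(1), of e f] Z(2) x(2) e f ZE by blast
      then show "f \<in> {e}" by simp
    qed (use a e in auto)
    then have "deg Z a = 1" by (simp add: deg_def)
    then show False using Z(1) unfolding even_set_def by (metis odd_one)
  qed
  then obtain e where e: "e \<in> Z" "e \<notin> F" by blast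
  then have eF': "e \<in> F'" by (simp add: F'_def)
  obtain x a where x: "x \<in> X" "a \<in> ends e" "(x, a) \<in> conn F" using dom[of e] e ZE by blast
  have "ends e \<subseteq> conn F `` {x}"
  proof
    fix b assume b: "b \<in> ends e"
    have xb: "(x, b) \<in> conn F'" using conn_touch[OF eF' x(2) b] x(3) sub by blast
    then have "b \<in> conn F `` X" using optimal_no_improvement(2)[OF evF' sub] x(1) by blast
    then obtain x' where x': "x' \<in> X" "(x', b) \<in> conn F" by auto
    have "(x, x') \<in> conn F'" by (rule conn_trans[OF xb conn_sym[OF subsetD[OF sub x'(2)]]])
    then have "x = x'" by (rule optimal_no_improvement(1)[OF evF' sub x(1) x'(1)])
    then show "b \<in> conn F `` {x}" using x' by simp
  qed
  then have "ends e \<subseteq> L \<inter> conn F `` {x}" using Z(2)[OF e(1)] by simp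
  then have "e \<in> F" using in_comp[OF x(1) subsetD[OF ZE e(1)]] by blast
  then show False using e by simp
qed

lemma few_edges_within:
  assumes L: "\<And>x. x \<in> X \<Longrightarrow> \<exists>a b. L \<inter> conn F `` {x} \<subseteq> {a, b} \<and> (a = b \<or> (\<exists>e\<in>F. ends e = {a, b}))"
    and "finite L" "L \<noteq> {}"
  shows "card {e \<in> E. ends e \<subseteq> L} < card L"
proof (rule ccontr)
  assume "\<not> ?thesis"
  then have "card L \<le> card {e \<in> E. ends e \<subseteq> L}" by simp
  then have "\<exists>Z\<subseteq>{e \<in> E. ends e \<subseteq> L}. Z \<noteq> {} \<and> even_set Z"
    by (intro ex_even_set[OF _ _ assms(2,3)]) auto
  then obtain Z where Z: "Z \<subseteq> {e \<in> E. ends e \<subseteq> L}" "Z \<noteq> {}" "even_set Z" by blast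
  have "Z = {}" by (rule no_even_set_within[OF L Z(3)]) (use Z(1) in auto)
  then show False using Z(2) by simp
qed

end

end

context edge_ends begin

context
  fixes F X
  assumes opt: "optimal F X"
begin

text \<open>
  For \<open>x \<in> trivials\<close> the component of \<open>x\<close> consists of \<open>x\<close> only, so a matching edge at \<open>x\<close> cannot be
  taken from \<open>F\<close>; it is to end in \<open>outer x\<close>.
\<close>
definition trivials :: "'l set" where
  "trivials = {x \<in> X. \<forall>e\<in>F. x \<notin> ends e}"

definition outer :: "'l \<Rightarrow> 'l set" where
  "outer x = {y. y \<notin> conn F `` X \<and> (\<exists>e\<in>E. ends e = {x, y})}"

lemma trivial_comp: "x \<in> trivials \<Longrightarrow> (x, l) \<in> conn F \<Longrightarrow> l = x"
  unfolding conn_def trivials_def by (erule converse_rtranclE) auto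

lemma X_conn: "x \<in> X \<Longrightarrow> x \<in> conn F `` X"
  using conn_refl by blast

text \<open>
  Let \<open>J\<close> be a smallest violation of Hall's condition and \<open>N\<close> its set of outer neighbours, so that
  \<open>card N = card J - 1\<close>. By minimality each member of \<open>N\<close> has two neighbours in \<open>J\<close>. These
  \<open>2 * card N\<close> edges exhaust the bound \<open>card (J \<union> N) - 1\<close> of \<open>few_edges_within\<close>, hence no edge
  lies within \<open>J\<close>. But then \<open>J\<close> can be replaced by the smaller set \<open>N\<close> of representatives.
\<close>
lemma hall_condition:
  assumes "J \<subseteq> trivials"
  shows "card J \<le> card (\<Union>(outer ` J))"
proof (rule ccontr)
  define bad where "bad J \<longleftrightarrow> J \<subseteq> trivials \<and> card (\<Union>(outer ` J)) < card J" for J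
  assume "\<not> ?thesis"
  then have "bad J" using assms by (simp add: bad_def)
  then obtain J where J: "bad J" and min: "\<And>J'. bad J' \<Longrightarrow> card J \<le> card J'"
    using ex_has_least_nat[of bad J card] by blast
  note finX = finX[OF opt] and dom = dom[OF opt]
  have JX: "J \<subseteq> X" and Jt: "J \<subseteq> trivials" using J by (auto simp: bad_def trivials_def)
  define N where "N = \<Union>(outer ` J)"
  have NJ: "card N < card J" using J by (simp add: bad_def N_def)
  have finJ: "finite J" using JX finX finite_subset by blast
  have finN: "finite N"
    by (rule finite_subset[OF _ finite_lines]) (auto simp: N_def outer_def)
  have out: "y \<notin> conn F `` X" if "y \<in> N" for y using that by (auto simp: N_def outer_def)
  have disj: "J \<inter> N = {}" using out X_conn JX by blast
  have Jne: "J \<noteq> {}" using NJ by auto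
  have pred: "card J - 1 \<le> card (\<Union>(outer ` (J - {x})))" if x: "x \<in> J" for x
  proof -
    have "card (J - {x}) < card J" using card_Diff1_less[OF finJ x] .
    then have "\<not> bad (J - {x})" using min by (meson not_le)
    then show ?thesis using Jt x finJ by (auto simp: bad_def)
  qed
  have subN: "\<Union>(outer ` (J - {x})) \<subseteq> N" for x by (auto simp: N_def)
  have JN: "card J - 1 \<le> card N"
  proof -
    obtain x where x: "x \<in> J" using Jne by auto
    show ?thesis using pred[OF x] card_mono[OF finN subN[of x]] by linarith
  qed
  define L where "L = J \<union> N"
  have few: "card {e \<in> E. ends e \<subseteq> L} < card L"
  proof (rule few_edges_within[OF opt])
    show "finite L" "L \<noteq> {}" using finJ finN Jne by (auto simp: L_def)
    fix x assume x: "x \<in> X"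
    have "L \<inter> conn F `` {x} \<subseteq> {x, x}"
    proof
      fix l assume l: "l \<in> L \<inter> conn F `` {x}"
      then have "l \<in> J" using out x by (auto simp: L_def)
      then have "l = x" using comp_unique[OF opt, of x l l] x l JX by auto
      then show "l \<in> {x, x}" by simp
    qed
    then show "\<exists>a b. L \<inter> conn F `` {x} \<subseteq> {a, b} \<and> (a = b \<or> (\<exists>e\<in>F. ends e = {a, b}))" by blast
  qed
  define S where "S y = {e \<in> E. y \<in> ends e \<and> ends e \<subseteq> L}" for y
  have two: "2 \<le> card (S y)" if y: "y \<in> N" for y
  proof -
    obtain x e where x: "x \<in> J" and e: "e \<in> E" "ends e = {x, y}"
      using y by (auto simp: N_def outer_def)
    have "\<Union>(outer ` (J - {x})) = N"
      by (rule card_seteq[OF finN subN]) (use pred[OF x] NJ in linarith)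
    then obtain x' e' where x': "x' \<in> J" "x' \<noteq> x" and e': "e' \<in> E" "ends e' = {x', y}"
      using y by (auto simp: outer_def)
    have "x' \<noteq> y" using x' y disj by blast
    then have "e \<noteq> e'" using e e' x' by auto
    then have "card {e, e'} = 2" by simp
    moreover have "{e, e'} \<subseteq> S y" using e e' x x' y by (auto simp: S_def L_def)
    moreover have "finite (S y)" using finE by (simp add: S_def)
    ultimately show ?thesis by (metis card_mono)
  qed
  have Sdisj: "S y \<inter> S y' = {}" if y: "y \<in> N" "y' \<in> N" "y \<noteq> y'" for y y'
  proof (rule ccontr)
    assume "S y \<inter> S y' \<noteq> {}"
    then obtain e where e: "e \<in> E" "{y, y'} \<subseteq> ends e" by (auto simp: S_def)
    have "{y, y'} = ends e"
      by (rule card_seteq[OF finite_ends[OF e(1)] e(2)]) (use card_ends[OF e(1)] y(3) in simp)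
    moreover obtain l where "l \<in> ends e" "l \<in> conn F `` X" using dom[OF e(1)] by blast
    ultimately have "l \<in> N" using y by auto
    then show False using out \<open>l \<in> conn F `` X\<close> by blast
  qed
  have "2 * card N \<le> (\<Sum>y\<in>N. card (S y))"
    using sum_mono[of N "\<lambda>_. 2" "\<lambda>y. card (S y)"] two by simp
  also have "\<dots> = card (\<Union>y\<in>N. S y)"
    by (rule card_UN_disjoint[symmetric]) (use finN finE Sdisj in \<open>auto simp: S_def\<close>)
  finally have many: "2 * card N \<le> card (\<Union>y\<in>N. S y)" .
  have no_inner: "\<not> ends e \<subseteq> J" if e: "e \<in> E" for e
  proof
    assume eJ: "ends e \<subseteq> J"
    have "e \<notin> (\<Union>y\<in>N. S y)" using eJ disj by (auto simp: S_def)
    then have "Suc (card (\<Union>y\<in>N. S y)) = card (insert e (\<Union>y\<in>N. S y))"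
      using finN finE by (simp add: S_def)
    also have "\<dots> \<le> card {e \<in> E. ends e \<subseteq> L}"
      by (rule card_mono) (use finE e eJ in \<open>auto simp: S_def L_def\<close>)
    finally have "2 * card N + 1 \<le> card {e \<in> E. ends e \<subseteq> L}" using many by linarith
    moreover have "card L = card J + card N"
      unfolding L_def by (rule card_Un_disjoint[OF finJ finN disj])
    ultimately show False using few JN by linarith
  qed
  have "dominating F (X - J \<union> N)"
    unfolding dominating_def
  proof (intro conjI ballI)
    show "even_set F" by (rule evF[OF opt])
    show "finite (X - J \<union> N)" using finX finN by simp
    fix e assume e: "e \<in> E"
    obtain x l where x: "x \<in> X" "l \<in> ends e" "(x, l) \<in> conn F" using dom[OF e] by blast
    show "ends e \<inter> conn F `` (X - J \<union> N) \<noteq> {}"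
    proof (cases "x \<in> J")
      case False
      then show ?thesis using x by blast
    next
      case True
      then have "l = x" using trivial_comp x(3) Jt by blast
      obtain z where z: "ends e = {x, z}" using other_end[OF e x(2)] \<open>l = x\<close> by metis
      show ?thesis
      proof (cases "z \<in> conn F `` X")
        case False
        then have "z \<in> N" using z e True by (auto simp: N_def outer_def)
        then show ?thesis using z conn_refl by blast
      next
        case zc: True
        then obtain x' where x': "x' \<in> X" "(x', z) \<in> conn F" by auto
        have "x' \<notin> J"
        proof
          assume "x' \<in> J"
          then have "z = x'" using trivial_comp x'(2) Jt by blast
          then show False using no_inner[OF e] z True \<open>x' \<in> J\<close> by simp
        qed
        then show ?thesis using x' z by blast
      qed
    qed
  qed
  then have "card X \<le> card (X - J \<union> N)" using opt by (auto simp: optimal_def)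
  also have "\<dots> \<le> card (X - J) + card N" by (rule card_Un_le)
  also have "card (X - J) = card X - card J" by (rule card_Diff_subset[OF finJ JX])
  finally show False using NJ card_mono[OF finX JX] by linarith
qed

text \<open>
  The edges \<open>t x\<close> form a matching. They are taken from \<open>F\<close> where possible, otherwise they are provided
  by Hall's theorem. In both cases the set of their ends satisfies the condition of
  \<open>few_edges_within\<close>.
\<close>
lemma ex_transversal:
  "\<exists>t z. (\<forall>x\<in>X. t x \<in> E \<and> ends (t x) = {x, z x} \<and> x \<noteq> z x) \<and> inj_on z X \<and> X \<inter> z ` X = {} \<and>
    (\<forall>x\<in>X. \<exists>a b. (X \<union> z ` X) \<inter> conn F `` {x} \<subseteq> {a, b} \<and> (a = b \<or> (\<exists>e\<in>F. ends e = {a, b})))"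
proof -
  have "finite (outer x)" for x
    by (rule finite_subset[OF _ finite_lines]) (auto simp: outer_def)
  moreover have "finite trivials" using finX[OF opt] by (simp add: trivials_def)
  ultimately have "\<exists>f. inj_on f trivials \<and> (\<forall>x\<in>trivials. f x \<in> outer x)"
    by (intro halls_marriage hall_condition)
  then obtain f where f: "inj_on f trivials" "\<forall>x\<in>trivials. f x \<in> outer x" by blast
  have "\<exists>e m. e \<in> E \<and> ends e = {x, m} \<and> x \<noteq> m \<and> (x \<in> trivials \<longrightarrow> m = f x) \<and> (x \<notin> trivials \<longrightarrow> e \<in> F)"
    if x: "x \<in> X" for x
  proof (cases "x \<in> trivials")
    case True
    then obtain e where "e \<in> E" "ends e = {x, f x}" using f(2) by (auto simp: outer_def)
    moreover have "x \<noteq> f x"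
    proof -
      have "f x \<notin> conn F `` X" using f(2) True unfolding outer_def by blast
      then show ?thesis using X_conn[OF x] by metis
    qed
    ultimately show ?thesis using True by blast
  next
    case False
    then obtain e where e: "e \<in> F" "x \<in> ends e" using x by (auto simp: trivials_def)
    then have "e \<in> E" using FE[OF opt] by blast
    then obtain m where "ends e = {x, m}" "x \<noteq> m" using other_end e(2) by metis
    then show ?thesis using False e \<open>e \<in> E\<close> by blast
  qed
  then obtain t z where tz: "\<And>x. x \<in> X \<Longrightarrow> t x \<in> E \<and> ends (t x) = {x, z x} \<and> x \<noteq> z x \<and>
      (x \<in> trivials \<longrightarrow> z x = f x) \<and> (x \<notin> trivials \<longrightarrow> t x \<in> F)" by metis
  have out: "z x \<notin> conn F `` X" if "x \<in> trivials" for x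
    using that tz[of x] f(2) by (auto simp: outer_def trivials_def)
  have inn: "(x, z x) \<in> conn F" if "x \<in> X" "x \<notin> trivials" for x
    using that tz[OF that(1)] conn_edge[of "t x" F x "z x"] by auto
  have zcomp: "x = x'" if "x \<in> X" "x' \<in> X" "(x', z x) \<in> conn F" for x x'
  proof (cases "x \<in> trivials")
    case True
    then show ?thesis using out that by blast
  next
    case False
    then show ?thesis using comp_unique[OF opt that(1,2) inn[OF that(1)] that(3)] by simp
  qed
  have "inj_on z X"
  proof (rule inj_onI)
    fix x x' assume x: "x \<in> X" "x' \<in> X" "z x = z x'"
    show "x = x'"
    proof (cases "x' \<in> trivials")
      case False
      then show ?thesis using zcomp[OF x(1,2)] inn[OF x(2)] x(3) by simp
    next
      case t': True
      have "x \<in> trivials"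
      proof (rule ccontr)
        assume "x \<notin> trivials"
        then have "z x \<in> conn F `` X" using inn[OF x(1)] x(1) by blast
        then show False using out[OF t'] x(3) by simp
      qed
      then show ?thesis using t' f(1) tz[OF x(1)] tz[OF x(2)] x(3) by (auto dest: inj_onD)
    qed
  qed
  moreover have "X \<inter> z ` X = {}"
  proof (rule ccontr)
    assume "X \<inter> z ` X \<noteq> {}"
    then obtain x where x: "x \<in> X" "z x \<in> X" by auto
    then have "x = z x" using zcomp[of x "z x"] by simp
    then show False using tz[OF x(1)] by simp
  qed
  moreover have "\<exists>a b. (X \<union> z ` X) \<inter> conn F `` {x} \<subseteq> {a, b} \<and> (a = b \<or> (\<exists>e\<in>F. ends e = {a, b}))"
    if x: "x \<in> X" for x
  proof (cases "x \<in> trivials")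
    case True
    then have "(X \<union> z ` X) \<inter> conn F `` {x} \<subseteq> {x, x}" using trivial_comp by blast
    then show ?thesis by blast
  next
    case False
    have "(X \<union> z ` X) \<inter> conn F `` {x} \<subseteq> {x, z x}"
    proof
      fix l assume l: "l \<in> (X \<union> z ` X) \<inter> conn F `` {x}"
      show "l \<in> {x, z x}"
      proof (cases "l \<in> X")
        case True
        then have "x = l" using comp_unique[OF opt x True, of l] l by simp
        then show ?thesis by simp
      next
        case False
        then obtain x' where "x' \<in> X" "l = z x'" using l by auto
        then show ?thesis using zcomp[of x' x] x l by auto
      qed
    qed
    then show ?thesis using tz[OF x] False by blast
  qed
  ultimately show ?thesis using tz by blast
qed

end

text \<open>
  Each edge outside the matching \<open>T\<close> shares an end with at most two members of \<open>T\<close>, and with two of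
  them only if both its ends are covered by \<open>T\<close>.
\<close>
lemma matching_degree_sum:
  assumes T: "T \<subseteq> E" and disj: "\<And>e f. e \<in> T \<Longrightarrow> f \<in> T \<Longrightarrow> e \<noteq> f \<Longrightarrow> ends e \<inter> ends f = {}"
  shows "(\<Sum>v\<in>T. card {w. share v w}) + 2 * card T
    \<le> card E + card {e \<in> E. ends e \<subseteq> \<Union>(ends ` T)}"
proof -
  define L where "L = \<Union>(ends ` T)"
  have finT: "finite T" using T finite_sub by blast
  have "(\<Sum>v\<in>T. card {w. share v w}) = (\<Sum>v\<in>T. \<Sum>w\<in>E. of_bool (share v w))"
  proof (rule sum.cong)
    fix v
    have "{w. share v w} = E \<inter> {w. share v w}" by (auto simp: share_def)
    then show "card {w. share v w} = (\<Sum>w\<in>E. of_bool (share v w))" using finE by simp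
  qed simp
  also have "\<dots> = (\<Sum>w\<in>E. \<Sum>v\<in>T. of_bool (share v w))" by (rule sum.swap)
  also have "\<dots> = (\<Sum>w\<in>E. card {v \<in> T. share v w})" using finT by (simp add: Int_def)
  also have "\<dots> = (\<Sum>w\<in>E - T. card {v \<in> T. share v w})"
  proof (rule sum.mono_neutral_right)
    show "\<forall>w\<in>E - (E - T). card {v \<in> T. share v w} = 0"
    proof
      fix w assume "w \<in> E - (E - T)"
      then have "{v \<in> T. share v w} = {}" using disj by (auto simp: share_def)
      then show "card {v \<in> T. share v w} = 0" by (simp only: card.empty)
    qed
  qed (use finE in auto)
  also have "\<dots> \<le> (\<Sum>w\<in>E - T. 1 + of_bool (ends w \<subseteq> L))"
  proof (rule sum_mono)
    fix w assume w: "w \<in> E - T"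
    have fw: "finite (ends w)" using w finite_ends by blast
    define g where "g v = (SOME l. l \<in> ends v \<inter> ends w)" for v
    have g: "g v \<in> ends v \<inter> ends w" if "v \<in> {v \<in> T. share v w}" for v
      unfolding g_def by (rule someI_ex) (use that in \<open>auto simp: share_def\<close>)
    have "inj_on g {v \<in> T. share v w}"
    proof (rule inj_onI)
      fix v v' assume v: "v \<in> {v \<in> T. share v w}" "v' \<in> {v \<in> T. share v w}" "g v = g v'"
      then have "g v \<in> ends v \<inter> ends v'" using g[OF v(1)] g[OF v(2)] by auto
      then show "v = v'" using disj[of v v'] v by auto
    qed
    then have "card {v \<in> T. share v w} = card (g ` {v \<in> T. share v w})" by (simp add: card_image)
    also have "\<dots> \<le> card (ends w \<inter> L)"
      by (rule card_mono) (use fw g in \<open>auto simp: L_def\<close>)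
    also have "\<dots> \<le> 1 + of_bool (ends w \<subseteq> L)"
    proof (cases "ends w \<subseteq> L")
      case True
      then have "card (ends w \<inter> L) = 2" using w card_ends by (simp add: Int_absorb2)
      then show ?thesis using True by simp
    next
      case False
      then have "card (ends w \<inter> L) < card (ends w)" using fw by (intro psubset_card_mono) auto
      then show ?thesis using w card_ends by simp
    qed
    finally show "card {v \<in> T. share v w} \<le> 1 + of_bool (ends w \<subseteq> L)" .
  qed
  also have "\<dots> = (\<Sum>w\<in>E - T. 1) + (\<Sum>w\<in>E - T. of_bool (ends w \<subseteq> L))" by (rule sum.distrib)
  also have "(\<Sum>w\<in>E - T. of_bool (ends w \<subseteq> L)) = card ((E - T) \<inter> {e. ends e \<subseteq> L})"
    using finE by simp
  also have "(E - T) \<inter> {e. ends e \<subseteq> L} = {e \<in> E - T. ends e \<subseteq> L}" by auto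
  also have "(\<Sum>w\<in>E - T. 1) = card (E - T)" by simp
  finally have main: "(\<Sum>v\<in>T. card {w. share v w}) \<le> card (E - T) + card {e \<in> E - T. ends e \<subseteq> L}" .
  have "card (E - T) + card T = card E"
    using T finE finT card_mono[OF finE T] by (simp add: card_Diff_subset)
  moreover have "card {e \<in> E - T. ends e \<subseteq> L} + card T = card {e \<in> E. ends e \<subseteq> L}"
  proof -
    have "{e \<in> E. ends e \<subseteq> L} = {e \<in> E - T. ends e \<subseteq> L} \<union> T" using T by (auto simp: L_def)
    then show ?thesis using finE finT by (simp add: card_Un_disjoint disjoint_iff)
  qed
  ultimately show ?thesis using main unfolding L_def by linarith
qed

theorem line_graph_cyc_partition:
  assumes sigma: "\<And>T. indep E share T \<Longrightarrow> card T = k + 1 \<Longrightarrow> card E \<le> (\<Sum>v\<in>T. card {w. share v w})"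
  shows "\<exists>P. cyc_partition E share P \<and> card P \<le> k"
proof -
  obtain F X where opt: "optimal F X" using ex_optimal by blast
  note finX = finX[OF opt] and dom = dom[OF opt]
  have "card X \<le> k"
  proof (rule ccontr)
    assume "\<not> card X \<le> k"
    then obtain X1 where X1: "X1 \<subseteq> X" "card X1 = k + 1"
      using obtain_subset_with_card_n[of "k + 1" X] by auto
    have fX1: "finite X1" using X1 finX finite_subset by blast
    from ex_transversal[OF opt] obtain t z where
      t0: "\<forall>x\<in>X. t x \<in> E \<and> ends (t x) = {x, z x} \<and> x \<noteq> z x"
      and z: "inj_on z X" "X \<inter> z ` X = {}"
      and comp0: "\<forall>x\<in>X. \<exists>a b. (X \<union> z ` X) \<inter> conn F `` {x} \<subseteq> {a, b}
        \<and> (a = b \<or> (\<exists>e\<in>F. ends e = {a, b}))"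
      by (elim exE conjE) (rule that)
    note t = bspec[OF t0] and comp = bspec[OF comp0]
    define L where "L = X1 \<union> z ` X1"
    have LX: "L \<subseteq> X \<union> z ` X" using X1 by (auto simp: L_def)
    define T where "T = t ` X1"
    have TE: "T \<subseteq> E" using t X1 by (auto simp: T_def)
    have disj_t: "ends (t x) \<inter> ends (t x') = {}" if "x \<in> X1" "x' \<in> X1" "x \<noteq> x'" for x x'
    proof -
      have xX: "x \<in> X" "x' \<in> X" using that X1 by auto
      have "z x \<noteq> z x'" using inj_onD[OF z(1)] xX that(3) by blast
      moreover have "x \<noteq> z x'" "x' \<noteq> z x" using z(2) xX by blast+
      ultimately show ?thesis using t[OF xX(1)] t[OF xX(2)] that(3) by auto
    qed
    have injt: "inj_on t X1"
    proof (rule inj_onI)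
      fix x x' assume x: "x \<in> X1" "x' \<in> X1" "t x = t x'"
      have "ends (t x) \<noteq> {}" using t x X1 by auto
      then show "x = x'" using disj_t[OF x(1,2)] x(3) by auto
    qed
    have cT: "card T = k + 1" using card_image[OF injt] X1 by (simp add: T_def)
    have disjT: "ends e \<inter> ends f = {}" if "e \<in> T" "f \<in> T" "e \<noteq> f" for e f
      using that disj_t unfolding T_def by blast
    then have "indep E share T" using TE unfolding indep_def share_def by blast
    then have "card E \<le> (\<Sum>v\<in>T. card {w. share v w})" using sigma cT by blast
    moreover have "(\<Sum>v\<in>T. card {w. share v w}) + 2 * card T
        \<le> card E + card {e \<in> E. ends e \<subseteq> \<Union>(ends ` T)}"
      by (rule matching_degree_sum[OF TE disjT])
    moreover have "\<Union>(ends ` T) = L"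
    proof -
      have "ends (t x) = {x, z x}" if "x \<in> X1" for x using t that X1 by blast
      then have "(\<Union>x\<in>X1. ends (t x)) = (\<Union>x\<in>X1. {x, z x})" by simp
      then show ?thesis by (auto simp: T_def L_def)
    qed
    moreover have "card {e \<in> E. ends e \<subseteq> L} < card L"
    proof (rule few_edges_within[OF opt])
      show "finite L" "L \<noteq> {}" using fX1 X1 by (auto simp: L_def)
      fix x assume "x \<in> X"
      from comp[OF this] obtain a b where ab: "(X \<union> z ` X) \<inter> conn F `` {x} \<subseteq> {a, b}"
        "a = b \<or> (\<exists>e\<in>F. ends e = {a, b})" by blast
      have "L \<inter> conn F `` {x} \<subseteq> {a, b}" using LX by (intro order_trans[OF Int_mono ab(1)]) auto
      then show "\<exists>a b. L \<inter> conn F `` {x} \<subseteq> {a, b} \<and> (a = b \<or> (\<exists>e\<in>F. ends e = {a, b}))"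
        using ab(2) by blast
    qed
    moreover have "card L \<le> 2 * card T"
      using card_Un_le[of X1 "z ` X1"] card_image_le[OF fX1, of z] cT X1(2) by (simp add: L_def)
    ultimately show False by simp
  qed
  have "\<forall>e\<in>E. \<exists>x. x \<in> X \<and> ends e \<inter> conn F `` {x} \<noteq> {}" using dom by blast
  then obtain a where a: "\<And>e. e \<in> E \<Longrightarrow> a e \<in> X \<and> ends e \<inter> conn F `` {a e} \<noteq> {}" by metis
  define W where "W x = {e \<in> E. a e = x}" for x
  define P where "P = W ` X - {{}}"
  have "partition_on E P"
  proof (rule partition_onI)
    show "\<Union>P = E" using a by (auto simp: P_def W_def)
    fix A B assume "A \<in> P" "B \<in> P" "A \<noteq> B"
    then show "disjnt A B" by (auto simp: P_def W_def disjnt_def)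
  qed (simp add: P_def)
  moreover have "cyclable share A" if A: "A \<in> P" for A
  proof -
    obtain x where x: "x \<in> X" "A = W x" "W x \<noteq> {}" using A by (auto simp: P_def)
    have "cyclable share (W x)"
    proof (rule cyclable_if_touches_component[OF evF[OF opt] _ x(3)])
      show "W x \<subseteq> E" by (auto simp: W_def)
      show "ends e \<inter> conn F `` {x} \<noteq> {}" if "e \<in> W x" for e using that a[of e] by (auto simp: W_def)
      show "{e \<in> F. ends e \<inter> conn F `` {x} \<noteq> {}} \<subseteq> W x"
      proof
        fix e assume "e \<in> {e \<in> F. ends e \<inter> conn F `` {x} \<noteq> {}}"
        then obtain l where e: "e \<in> F" "l \<in> ends e" "(x, l) \<in> conn F" by auto
        have eE: "e \<in> E" using e(1) FE[OF opt] by blast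
        obtain l' where l': "l' \<in> ends e" "(a e, l') \<in> conn F" using a[OF eE] by blast
        have "(x, l') \<in> conn F" using conn_touch[OF e(1,2) l'(1) e(3)] .
        then have "a e = x" using comp_unique[OF opt _ x(1) l'(2)] a[OF eE] by blast
        then show "e \<in> W x" using eE by (simp add: W_def)
      qed
    qed
    then show ?thesis using x(2) by simp
  qed
  moreover have "card P \<le> k"
  proof -
    have "card P \<le> card (W ` X)" unfolding P_def by (rule card_mono) (use finX in auto)
    also have "\<dots> \<le> card X" by (rule card_image_le[OF finX])
    finally show ?thesis using \<open>card X \<le> k\<close> by simp
  qed
  ultimately show ?thesis unfolding cyc_partition_def by blast
qed

end

section \<open>Diamond-free claw-free graphs are line graphs\<close>

context claw_free_ugraph
begin

text \<open>
  In a graph without diamonds the line of two adjacent vertices is the only maximal clique that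
  contains them.
\<close>
definition line :: "'a \<Rightarrow> 'a \<Rightarrow> 'a set" where
  "line v u = {v, u} \<union> (nb v \<inter> nb u)"

text \<open>
  A vertex with complete neighbourhood lies in only one line; the singleton serves as its second one,
  so that every vertex has two lines. As vertices of \<open>H\<close> the singletons have degree one.
\<close>
definition lines :: "'a \<Rightarrow> 'a set set" where
  "lines v = line v ` nb v \<union> (if \<forall>a\<in>nb v. \<forall>b\<in>nb v. a \<noteq> b \<longrightarrow> adj a b then {{v}} else {})"

context
  assumes diamond_free: "\<And>x b c d. \<lbrakk>adj x b; adj x c; adj x d; adj b c; adj b d; c \<noteq> d\<rbrakk> \<Longrightarrow> adj c d"
    and no_isolated: "\<And>v. v \<in> V \<Longrightarrow> nb v \<noteq> {}"
begin

lemma line_sym: "line v u = line u v"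
  unfolding line_def by auto

lemma line_eq_iff:
  assumes "adj v u" "adj v u'"
  shows "line v u = line v u' \<longleftrightarrow> u = u' \<or> adj u u'"
proof -
  have sub: "line v u \<subseteq> line v u'" if "adj v u" "adj v u'" "adj u u'" for u u'
  proof
    fix z assume "z \<in> line v u"
    then consider "z = v" | "z = u" | "adj v z" "adj u z" by (auto simp: line_def)
    then show "z \<in> line v u'"
    proof cases
      case 3
      then have "z = u' \<or> adj z u'" using diamond_free[of v u z u'] that by auto
      then show ?thesis using 3 adj_sym by (auto simp: line_def)
    qed (use that adj_sym in \<open>auto simp: line_def\<close>)
  qed
  show ?thesis
  proof
    assume "line v u = line v u'"
    then have "u' \<in> line v u" by (auto simp: line_def)
    then show "u = u' \<or> adj u u'" using assms adj_irrefl by (auto simp: line_def)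
  next
    assume "u = u' \<or> adj u u'"
    then show "line v u = line v u'" using sub[of u u'] sub[of u' u] assms adj_sym by blast
  qed
qed

text \<open>
  Without diamonds, being equal or adjacent is an equivalence relation on the neighbours of \<open>v\<close>, whose
  classes correspond to the lines of \<open>v\<close>; without claws there are at most two classes.
\<close>
lemma card_lines:
  assumes v: "v \<in> V"
  shows "card (lines v) = 2"
proof (cases "\<forall>a\<in>nb v. \<forall>b\<in>nb v. a \<noteq> b \<longrightarrow> adj a b")
  case True
  obtain u where u: "adj v u" using no_isolated[OF v] by auto
  have "line v ` nb v = {line v u}"
  proof (intro equalityI subsetI)
    fix L assume "L \<in> line v ` nb v"
    then obtain w where w: "adj v w" "L = line v w" by auto
    have "u = w \<or> adj u w" using True u w(1) by blast
    then show "L \<in> {line v u}" using line_eq_iff[OF u w(1)] w(2) by simp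
  qed (use u in auto)
  then have "lines v = {line v u, {v}}" unfolding lines_def if_P[OF True] by auto
  moreover have "line v u \<noteq> {v}" using u adj_irrefl by (auto simp: line_def)
  ultimately show ?thesis by simp
next
  case False
  then obtain a b where ab: "adj v a" "adj v b" "a \<noteq> b" "\<not> adj a b" by auto
  have "line v ` nb v = {line v a, line v b}"
  proof (intro equalityI subsetI)
    fix L assume "L \<in> line v ` nb v"
    then obtain w where w: "adj v w" "L = line v w" by auto
    have "w = a \<or> w = b \<or> adj w a \<or> adj w b"
      using no_claw[of v a b w] ab w(1) adj_sym by blast
    then show "L \<in> {line v a, line v b}"
      using line_eq_iff[OF w(1) ab(1)] line_eq_iff[OF w(1) ab(2)] w(2) by auto
  qed (use ab in auto)
  moreover have "line v a \<noteq> line v b" using line_eq_iff[OF ab(1,2)] ab by simp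
  moreover have "lines v = line v ` nb v" unfolding lines_def if_not_P[OF False] by simp
  ultimately show ?thesis by simp
qed

lemma in_linesD: "L \<in> lines v \<Longrightarrow> L = {v} \<or> (\<exists>u. adj v u \<and> L = line v u)"
  unfolding lines_def by (auto split: if_splits)

lemma in_lines_self: "L \<in> lines v \<Longrightarrow> v \<in> L"
  using in_linesD by (fastforce simp: line_def)

lemma adj_if_common_line:
  assumes "L \<in> lines v" "L \<in> lines w" "v \<noteq> w"
  shows "adj v w \<and> L = line v w"
proof -
  have "w \<in> L" using in_lines_self assms(2) .
  then obtain u where u: "adj v u" "L = line v u" using in_linesD[OF assms(1)] assms(3) by auto
  then have "u = w \<or> (adj v w \<and> adj u w)" using \<open>w \<in> L\<close> assms(3) by (auto simp: line_def)
  then show ?thesis using u line_eq_iff[of v u w] by auto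
qed

lemma edge_ends_lines: "edge_ends V lines"
proof
  show "finite V" by (rule finV)
  show "card (lines e) = 2" if "e \<in> V" for e using card_lines[OF that] .
  show "inj_on lines V"
  proof (rule inj_onI)
    fix v w assume vw: "v \<in> V" "w \<in> V" "lines v = lines w"
    show "v = w"
    proof (rule ccontr)
      assume ne: "v \<noteq> w"
      have "L = line v w" if "L \<in> lines v" for L
        using adj_if_common_line[OF that _ ne] that vw(3) by simp
      then have "lines v \<subseteq> {line v w}" by blast
      then have "card (lines v) \<le> 1" using card_mono[of "{line v w}" "lines v"] by simp
      then show False using card_lines[OF vw(1)] by simp
    qed
  qed
qed

lemma adj_eq_share: "edge_ends.share V lines = adj"
proof (intro ext)
  fix v w
  interpret edge_ends V lines by (rule edge_ends_lines)
  show "share v w = adj v w"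
  proof
    assume "share v w"
    then obtain L where "L \<in> lines v" "L \<in> lines w" "v \<noteq> w" by (auto simp: share_def)
    then show "adj v w" using adj_if_common_line by blast
  next
    assume a: "adj v w"
    have sub: "line u ` nb u \<subseteq> lines u" for u by (simp add: lines_def)
    have "line v w \<in> lines v" using sub[of v] a by blast
    moreover have "line v w \<in> lines w" using sub[of w] adj_sym[OF a] line_sym[of v w] by auto
    moreover have "v \<in> V" "w \<in> V" "v \<noteq> w" using adj_in[OF a] a adj_irrefl by auto
    ultimately show "share v w" unfolding share_def by blast
  qed
qed

end
end

text \<open>
  Induction on the number of non-adjacent pairs: a local completion at a diamond reduces it, and
  without diamonds the graph is a line graph.
\<close>
theorem claw_free_cyc_partition:
  assumes "claw_free_ugraph V adj"
    and "\<And>v. v \<in> V \<Longrightarrow> {w. adj v w} \<noteq> {}"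
    and "\<And>T. indep V adj T \<Longrightarrow> card T = k + 1 \<Longrightarrow> card V \<le> (\<Sum>v\<in>T. card {w. adj v w})"
  shows "\<exists>P. cyc_partition V adj P \<and> card P \<le> k"
  using assms
proof (induction "card {(u, w). u \<in> V \<and> w \<in> V \<and> \<not> adj u w}" arbitrary: adj rule: less_induct)
  case less
  interpret claw_free_ugraph V adj by (rule less.prems(1))
  show ?case
  proof (cases "\<exists>x b c d. adj x b \<and> adj x c \<and> adj x d \<and> adj b c \<and> adj b d \<and> c \<noteq> d \<and> \<not> adj c d")
    case True
    then obtain x b c d where diamond: "adj x b" "adj x c" "adj x d" "adj b c" "adj b d" "c \<noteq> d"
      "\<not> adj c d" by blast
    let ?a = "local_completion adj x"
    have sup: "?a u w" if "adj u w" for u w using that by (simp add: local_completion_def)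
    interpret L: claw_free_ugraph V ?a by (rule claw_free_local_completion)
    have "\<exists>P. cyc_partition V ?a P \<and> card P \<le> k"
    proof (rule less.hyps)
      let ?N = "{(u, w). u \<in> V \<and> w \<in> V \<and> \<not> adj u w}"
      let ?N' = "{(u, w). u \<in> V \<and> w \<in> V \<and> \<not> ?a u w}"
      have "finite ?N" by (rule finite_subset[of _ "V \<times> V"]) (use finV in auto)
      moreover have "?N' \<subset> ?N"
      proof
        show "?N' \<subseteq> ?N" using sup by auto
        have "(c, d) \<in> ?N" "(c, d) \<notin> ?N'"
          using diamond adj_in by (auto simp: local_completion_def)
        then show "?N' \<noteq> ?N" by blast
      qed
      ultimately show "card ?N' < card ?N" by (rule psubset_card_mono)
      show "claw_free_ugraph V ?a" by (rule L.claw_free_ugraph_axioms)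
      show "{w. ?a v w} \<noteq> {}" if "v \<in> V" for v using less.prems(2)[OF that] sup by auto
      fix T assume T: "indep V ?a T" "card T = k + 1"
      then have "indep V adj T" using sup unfolding indep_def by blast
      then have "card V \<le> (\<Sum>v\<in>T. card {w. adj v w})" using less.prems(3) T(2) by blast
      also have "\<dots> \<le> (\<Sum>v\<in>T. card {w. ?a v w})"
        by (intro sum_mono card_mono L.finite_nb) (use sup in auto)
      finally show "card V \<le> (\<Sum>v\<in>T. card {w. ?a v w})" .
    qed
    then obtain P' where P': "cyc_partition V ?a P'" "card P' \<le> k" by blast
    then show ?thesis using cyc_partition_of_local_completion[OF diamond P'(1)] by (meson order_trans)
  next
    case False
    then have df: "\<And>x b c d. \<lbrakk>adj x b; adj x c; adj x d; adj b c; adj b d; c \<noteq> d\<rbrakk> \<Longrightarrow> adj c d"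
      by blast
    interpret H: edge_ends V lines by (rule edge_ends_lines[OF df less.prems(2)])
    have "H.share = adj" by (rule adj_eq_share[OF df less.prems(2)])
    then show ?thesis using H.line_graph_cyc_partition[of k] less.prems(3) by simp
  qed
qed

section \<open>Two-factors of digraphs\<close>

definition cyc_adj :: "'a list \<Rightarrow> 'a \<Rightarrow> 'a \<Rightarrow> bool" where
  "cyc_adj c u v \<longleftrightarrow> (\<exists>i<length c. (u = c ! i \<and> v = c ! (Suc i mod length c))
     \<or> (v = c ! i \<and> u = c ! (Suc i mod length c)))"

lemma cyc_adj_sym: "cyc_adj c u v \<Longrightarrow> cyc_adj c v u"
  unfolding cyc_adj_def by blast

lemma cyc_adj_in: "cyc_adj c u v \<Longrightarrow> u \<in> set c"
proof -
  assume "cyc_adj c u v"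
  then obtain i where i: "i < length c" "u = c ! i \<or> u = c ! (Suc i mod length c)"
    unfolding cyc_adj_def by blast
  moreover have "Suc i mod length c < length c" using i(1) by (intro mod_less_divisor) linarith
  ultimately show ?thesis by auto
qed

lemma cyc_adj_imp_adj:
  assumes c: "cyc_list adj c" "3 \<le> length c" and sym: "\<And>u v. adj u v \<Longrightarrow> adj v u"
    and uv: "cyc_adj c u v"
  shows "adj u v"
proof -
  have step: "adj (c ! i) (c ! (Suc i mod length c))" if "i < length c" for i
  proof (cases "Suc i < length c")
    case True
    then show ?thesis using c(1) successively_nth[of adj c i] by (simp add: cyc_list_def)
  next
    case False
    then have i: "i = length c - 1" "Suc i = length c" using that by simp_all
    have "c \<noteq> []" using c by (simp add: cyc_list_def)
    then have "c ! i = last c" "c ! (Suc i mod length c) = hd c"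
      using i by (simp_all add: last_conv_nth hd_conv_nth)
    then show ?thesis using c by (auto simp: cyc_list_def)
  qed
  show ?thesis using uv step sym unfolding cyc_adj_def by blast
qed

lemma card_cyc_adj:
  assumes d: "distinct c" and n: "3 \<le> length c" and u: "u \<in> set c"
  shows "card {v. cyc_adj c u v} = 2"
proof -
  let ?n = "length c"
  obtain i where i: "i < ?n" "u = c ! i" using u by (auto simp: in_set_conv_nth)
  define p where "p = (if i = 0 then ?n - 1 else i - 1)"
  define s where "s = (if Suc i = ?n then 0 else Suc i)"
  have lt: "p < ?n" "s < ?n" using i n by (auto simp: p_def s_def)
  have ps: "p \<noteq> s" using i n by (auto simp: p_def s_def)
  have sm: "Suc i mod ?n = s" using i by (auto simp: s_def)
  have pm: "Suc j mod ?n = i \<longleftrightarrow> j = p" if "j < ?n" for j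
    using that i n by (auto simp: p_def mod_Suc)
  have "{v. cyc_adj c u v} = {c ! s, c ! p}"
  proof (intro equalityI subsetI)
    fix v assume "v \<in> {v. cyc_adj c u v}"
    then obtain j where j: "j < ?n" "(c ! i = c ! j \<and> v = c ! (Suc j mod ?n)) \<or>
        (v = c ! j \<and> c ! i = c ! (Suc j mod ?n))"
      unfolding cyc_adj_def i(2) by blast
    from j(2) show "v \<in> {c ! s, c ! p}"
    proof
      assume h: "c ! i = c ! j \<and> v = c ! (Suc j mod ?n)"
      then have "j = i" using nth_eq_iff_index_eq[OF d i(1) j(1)] by simp
      then show ?thesis using h sm by simp
    next
      assume h: "v = c ! j \<and> c ! i = c ! (Suc j mod ?n)"
      have "Suc j mod ?n < ?n" using j(1) by (intro mod_less_divisor) linarith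
      then have "Suc j mod ?n = i" using nth_eq_iff_index_eq[OF d i(1)] h by metis
      then show ?thesis using pm[OF j(1)] h by simp
    qed
  next
    fix v assume "v \<in> {c ! s, c ! p}"
    then show "v \<in> {v. cyc_adj c u v}"
      using i lt sm pm[OF lt(1)] unfolding cyc_adj_def by auto
  qed
  moreover have "c ! s \<noteq> c ! p" using nth_eq_iff_index_eq[OF d lt(2,1)] ps by simp
  ultimately show ?thesis by simp
qed

lemma ugraph_of_graph:
  assumes "graph G"
  shows "ugraph (verts G) (\<lambda>u v. (u, v) \<in> arcs_ends G)"
proof -
  interpret graph G by fact
  show ?thesis
  proof
    show "finite (verts G)" by simp
    show "(v, u) \<in> arcs_ends G" if "(u, v) \<in> arcs_ends G" for u v
      using arcs_ends_symmetric[OF sym_arcs that] .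
    show "u \<in> verts G \<and> v \<in> verts G" if "(u, v) \<in> arcs_ends G" for u v
      using adj_in_verts[OF that] by simp
    show "(v, v) \<notin> arcs_ends G" for v using adj_not_same by blast
  qed
qed

lemma out_degree_eq_card_neighbours:
  assumes "graph G"
  shows "out_degree G v = card {w. (v, w) \<in> arcs_ends G}"
proof -
  interpret graph G by fact
  have "inj_on (head G) (out_arcs G v)"
    by (rule inj_onI) (auto simp: out_arcs_def arc_to_ends_def intro: no_multi_arcs)
  moreover have "head G ` out_arcs G v = {w. (v, w) \<in> arcs_ends G}"
    by (auto simp: out_arcs_def arcs_ends_conv image_iff)
  ultimately show ?thesis unfolding out_degree_def by (metis card_image)
qed

text \<open>
  The four vertices of a claw induce a complete bipartite graph with parts of one and three vertices.
\<close>
lemma claw_free_ugraph_of_graph: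
  assumes G: "graph G" and cf: "claw_free G"
  shows "claw_free_ugraph (verts G) (\<lambda>u v. (u, v) \<in> arcs_ends G)"
proof -
  interpret graph G by (rule G)
  interpret U: ugraph "verts G" "\<lambda>u v. (u, v) \<in> arcs_ends G" by (rule ugraph_of_graph[OF G])
  show ?thesis
  proof (unfold_locales, rule ccontr)
    fix v p q r
    assume adj: "(v, p) \<in> arcs_ends G" "(v, q) \<in> arcs_ends G" "(v, r) \<in> arcs_ends G"
      and ne: "p \<noteq> q" "p \<noteq> r" "q \<noteq> r"
      and "\<not> ((p, q) \<in> arcs_ends G \<or> (p, r) \<in> arcs_ends G \<or> (q, r) \<in> arcs_ends G)"
    then have nadj: "(p, q) \<notin> arcs_ends G" "(p, r) \<notin> arcs_ends G" "(q, r) \<notin> arcs_ends G" by auto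
    define S where "S = {v, p, q, r}"
    have SV: "S \<subseteq> verts G" using adj U.adj_in by (auto simp: S_def)
    define H where "H = G \<restriction> S"
    have ind: "induced_subgraph H G" unfolding H_def by (rule induced_induce[OF SV])
    have endsH: "(a, b) \<in> arcs_ends H \<longleftrightarrow> (a, b) \<in> arcs_ends G \<and> a \<in> S \<and> b \<in> S" for a b
      by (auto simp: H_def arcs_ends_conv)
    have vne: "v \<noteq> p" "v \<noteq> q" "v \<noteq> r" using adj U.adj_irrefl by auto
    have gH: "graph H"
    proof -
      interpret H: wf_digraph H unfolding H_def by (rule wellformed_induce_subgraph)
      have "symmetric H" by (rule induced_graph_imp_symmetric[OF sym_arcs ind])
      moreover have "digraph H"
        using no_loops no_multi_arcs finite_arcs
        by unfold_locales (auto simp: H_def S_def arc_to_ends_def)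
      ultimately show ?thesis by (rule digraph.graphI[rotated])
    qed
    have eH: "arcs_ends H = {v} \<times> {p, q, r} \<union> {p, q, r} \<times> {v}"
    proof -
      have "(p, v) \<in> arcs_ends G" "(q, v) \<in> arcs_ends G" "(r, v) \<in> arcs_ends G"
        using adj by (blast intro: U.adj_sym)+
      moreover have "(q, p) \<notin> arcs_ends G" "(r, p) \<notin> arcs_ends G" "(r, q) \<notin> arcs_ends G"
        using nadj by (blast dest: U.adj_sym)+
      ultimately show ?thesis
        using adj nadj by (auto simp: endsH S_def U.adj_irrefl)
    qed
    have vH: "verts H = {v} \<union> {p, q, r}" by (auto simp: H_def S_def)
    have dj: "{v} \<inter> {p, q, r} = {}" using vne by simp
    have c: "card {v} = 1" "card {p, q, r} = 3" using ne by simp_all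
    have "complete_bipartite_digraph 1 3 H"
      unfolding complete_bipartite_digraph_def using gH vH dj c eH by blast
    then show False using cf ind unfolding claw_free_def by blast
  qed
qed

text \<open>
  The arcs between consecutive vertices of the cycles form the 2-factor. Each component contains one
  of the cycles, namely the one through any of its vertices, which bounds their number.
\<close>
lemma two_factor_of_cyc_partition:
  assumes G: "graph G"
    and P: "cyc_partition (verts G) (\<lambda>u v. (u, v) \<in> arcs_ends G) P"
    and large: "\<And>W. W \<in> P \<Longrightarrow> 3 \<le> card W"
  shows "\<exists>F. two_factor F G \<and> num_components F \<le> card P"
proof -
  interpret graph G by (rule G)
  define adj where "adj u v \<longleftrightarrow> (u, v) \<in> arcs_ends G" for u v
  interpret U: ugraph "verts G" adj unfolding adj_def by (rule ugraph_of_graph[OF G])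
  have P: "cyc_partition (verts G) adj P" using P unfolding adj_def .
  have part: "partition_on (verts G) P" using P by (simp add: cyc_partition_def)
  have finP: "finite P" by (rule U.finite_cyc_partition[OF P])
  have "\<exists>c. cyc_list adj c \<and> set c = W" if "W \<in> P" for W
    using P that by (auto simp: cyc_partition_def cyclable_def)
  then obtain c where c: "\<And>W. W \<in> P \<Longrightarrow> cyc_list adj (c W) \<and> set (c W) = W" by metis
  have dc: "distinct (c W)" and lc: "3 \<le> length (c W)" if "W \<in> P" for W
  proof -
    show "distinct (c W)" using c[OF that] by (simp add: cyc_list_def)
    then show "3 \<le> length (c W)" using large[OF that] c[OF that] distinct_card by metis
  qed
  define R where "R u v \<longleftrightarrow> (\<exists>W\<in>P. cyc_adj (c W) u v)" for u v
  have R_sym: "R v u" if "R u v" for u v using that cyc_adj_sym unfolding R_def by metis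
  have R_adj: "adj u v" if "R u v" for u v
  proof -
    obtain W where W: "W \<in> P" "cyc_adj (c W) u v" using \<open>R u v\<close> by (auto simp: R_def)
    show ?thesis
      by (rule cyc_adj_imp_adj[OF _ lc[OF W(1)] U.adj_sym W(2)]) (use c[OF W(1)] in simp)
  qed
  have R_at: "R u v \<longleftrightarrow> cyc_adj (c W) u v" if "W \<in> P" "u \<in> W" for u v W
  proof
    assume "R u v"
    then obtain W' where W': "W' \<in> P" "cyc_adj (c W') u v" by (auto simp: R_def)
    then have "u \<in> W'" using cyc_adj_in c by metis
    then have "W' = W" using partition_on_parts_eq[OF part W'(1) that(1)] that(2) by blast
    then show "cyc_adj (c W) u v" using W' by simp
  qed (use that in \<open>auto simp: R_def\<close>)
  define F where "F = G\<lparr>arcs := {a \<in> arcs G. R (tail G a) (head G a)}\<rparr>"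
  have simps: "verts F = verts G" "tail F = tail G" "head F = head G"
      "arcs F = {a \<in> arcs G. R (tail G a) (head G a)}" by (simp_all add: F_def)
  have endsF: "(u, v) \<in> arcs_ends F \<longleftrightarrow> R u v" for u v
    using R_adj[of u v] unfolding arcs_ends_conv adj_def by (auto simp: simps)
  interpret F: wf_digraph F by unfold_locales (auto simp: simps)
  have symF: "symmetric F" unfolding symmetric_def sym_def using endsF R_sym by blast
  have "digraph F"
    using no_loops no_multi_arcs
    by unfold_locales (auto simp: simps arc_to_ends_def)
  then have gF: "graph F" using symF by (rule digraph.graphI)
  interpret F: graph F by (rule gF)
  have "subgraph F G"
    using wf_digraph F.wf_digraph by (auto simp: subgraph_def compatible_def simps)
  moreover have "out_degree F v = 2" if v: "v \<in> verts F" for v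
  proof -
    obtain W where W: "W \<in> P" "v \<in> W" using v part by (auto simp: simps partition_on_def)
    have "out_degree F v = card {w. R v w}"
      using out_degree_eq_card_neighbours[OF gF] endsF by simp
    also have "\<dots> = card {w. cyc_adj (c W) v w}" using R_at[OF W] by simp
    also have "\<dots> = 2" by (rule card_cyc_adj[OF dc[OF W(1)] lc[OF W(1)]]) (use c W in auto)
    finally show ?thesis .
  qed
  ultimately have "two_factor F G" using gF by (auto simp: two_factor_def spanning_def simps)
  moreover have "num_components F \<le> card P"
  proof -
    have reach: "hd (c W) \<rightarrow>\<^sup>*\<^bsub>F\<^esub> v" if W: "W \<in> P" "v \<in> W" for W v
    proof -
      have WV: "W \<subseteq> verts F" using W part by (auto simp: simps partition_on_def)
      have ne: "c W \<noteq> []" using lc[OF W(1)] by auto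
      have hin: "hd (c W) \<in> verts F" using c[OF W(1)] ne WV hd_in_set by blast
      have "i < length (c W) \<Longrightarrow> hd (c W) \<rightarrow>\<^sup>*\<^bsub>F\<^esub> (c W ! i)" for i
      proof (induction i)
        case 0
        then show ?case using hin ne F.reachable_refl by (simp add: hd_conv_nth)
      next
        case (Suc i)
        have "cyc_adj (c W) (c W ! i) (c W ! Suc i)"
          unfolding cyc_adj_def using Suc.prems by (intro exI[of _ i]) auto
        then have "(c W ! i, c W ! Suc i) \<in> arcs_ends F" using endsF W(1) by (auto simp: R_def)
        then show ?case using Suc F.reachable_adjI F.reachable_trans by (meson Suc_lessD)
      qed
      then show ?thesis using c[OF W(1)] W(2) by (metis in_set_conv_nth)
    qed
    have sub: "F.sccs_verts \<subseteq> (\<lambda>W. F.scc_of (hd (c W))) ` P"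
    proof
      fix S assume "S \<in> F.sccs_verts"
      then obtain v where v: "v \<in> verts F" "S = F.scc_of v" unfolding F.sccs_verts_conv_scc_of by auto
      then obtain W where W: "W \<in> P" "v \<in> W" using part by (auto simp: simps partition_on_def)
      have "v \<in> F.scc_of (hd (c W))" by (rule F.scc_ofI_reachable'[OF reach[OF W]])
      then have "S = F.scc_of (hd (c W))" using F.scc_of_eq v(2) by simp
      then show "S \<in> (\<lambda>W. F.scc_of (hd (c W))) ` P" using W(1) by blast
    qed
    have fin: "finite F.sccs_verts" by (rule finite_surj[OF finP sub])
    have le: "card F.sccs_verts \<le> card P" by (rule surj_card_le[OF finP sub])
    have "num_components F = card (induce_subgraph F ` F.sccs_verts)"
      unfolding num_components_def F.sccs_conv_sccs_verts ..
    also have "\<dots> \<le> card F.sccs_verts" by (rule card_image_le[OF fin])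
    finally show ?thesis using le by simp
  qed
  ultimately show ?thesis by blast
qed

theorem corollary8:
  fixes G :: "('a, 'b) pre_digraph" and k n :: nat
  assumes "k > 0"
    and "graph G"
    and "claw_free G"
    and "card (verts G) = n"
    and "degree_sum (k + 1) G \<ge> enat n"
    and "min_degree G \<ge> indep_number G + 1"
  shows "\<exists>F. two_factor F G \<and> num_components F \<le> k"
proof -
  interpret graph G by fact
  define adj where "adj u v \<longleftrightarrow> (u, v) \<in> arcs_ends G" for u v
  interpret claw_free_ugraph "verts G" adj
    unfolding adj_def by (rule claw_free_ugraph_of_graph[OF assms(2,3)])
  have deg: "out_degree G v = card (nb v)" for v
    unfolding adj_def by (rule out_degree_eq_card_neighbours[OF assms(2)])
  have indep_iff: "indep_set G I \<longleftrightarrow> indep (verts G) adj I" for I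
    by (simp add: indep_set_def indep_def adj_def)
  have alpha: "card I \<le> indep_number G" if I: "indep (verts G) adj I" for I
  proof -
    have "finite {card I | I. indep_set G I}"
      by (rule finite_subset[of _ "card ` Pow (verts G)"]) (auto simp: indep_set_def)
    then show ?thesis unfolding indep_number_def using I indep_iff by (intro Max_ge) auto
  qed
  have delta: "indep_number G + 1 \<le> card (nb v)" if v: "v \<in> verts G" for v
  proof -
    have "min_degree G \<le> out_degree G v"
      unfolding min_degree_def using v by (intro Min_le) auto
    then show ?thesis using assms(6) deg by simp
  qed
  have "\<exists>P. cyc_partition (verts G) adj P \<and> card P \<le> k"
  proof (rule claw_free_cyc_partition)
    show "claw_free_ugraph (verts G) adj" by (rule claw_free_ugraph_axioms)
    show "nb v \<noteq> {}" if "v \<in> verts G" for v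
    proof -
      have "card (nb v) \<noteq> 0" using delta[OF that] by linarith
      then show ?thesis by (metis card.empty)
    qed
    fix T assume T: "indep (verts G) adj T" "card T = k + 1"
    let ?S = "{\<Sum>v\<in>I. out_degree G v | I. indep_set G I \<and> card I = k + 1}"
    have "k + 1 \<le> indep_number G" using alpha[OF T(1)] T(2) by simp
    then have "degree_sum (k + 1) G = enat (Min ?S)" by (simp add: degree_sum_def)
    then have "n \<le> Min ?S" using assms(5) by simp
    also have "\<dots> \<le> (\<Sum>v\<in>T. out_degree G v)"
    proof (rule Min_le)
      show "finite ?S"
        by (rule finite_subset[of _ "(\<lambda>I. \<Sum>v\<in>I. out_degree G v) ` Pow (verts G)"])
          (auto simp: indep_set_def)
      show "(\<Sum>v\<in>T. out_degree G v) \<in> ?S" using T indep_iff by blast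
    qed
    finally show "card (verts G) \<le> (\<Sum>v\<in>T. card (nb v))" using assms(4) deg by simp
  qed
  then obtain P0 where P0: "cyc_partition (verts G) adj P0" "card P0 \<le> k" by blast
  obtain P where P: "cyc_partition (verts G) adj P"
    and minimal: "\<And>P'. cyc_partition (verts G) adj P' \<Longrightarrow> card P \<le> card P'"
    using ex_has_least_nat[of "cyc_partition (verts G) adj" P0 card] P0(1) by blast
  have "3 \<le> card W" if "W \<in> P" for W
    by (rule minimal_cyc_partition_no_small_parts[OF P minimal alpha delta that])
  then have "\<exists>F. two_factor F G \<and> num_components F \<le> card P"
    using two_factor_of_cyc_partition[OF assms(2)] P unfolding adj_def by blast
  then show ?thesis using minimal[OF P0(1)] P0(2) by (meson order_trans)
qed

end
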